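(* Let $x\ge 0$ and $T\ge 1$. Then $$\max\left\{R_1^{\mathrm{AU}},R_1^{\mathrm{AU\text{-}FH}}\right\}\le\frac{8C_h\left(2+e^{\underline{\gamma}K_h/2}\left(4+e^{\underline{\gamma}x/2}\right)\right)}{\sigma^2\underline{\gamma}(2\gamma-\underline{\gamma})}\left(\log_2T+2\right),$$ $$\max\left\{R_4^{\mathrm{AU}},R_4^{\mathrm{AU\text{-}FH}}\right\}\le\frac{8C_h\left(2+e^{\underline{\gamma}(x+K_h)/2}\right)}{\sigma^2\underline{\gamma}(2\gamma-\underline{\gamma})}.$$
   Context: Setting. $B$ is a standard Brownian motion on a filtered probability space $(\Omega,\mathcal F,\{\mathcal F_t\},\mathbb P)$ (adapted to $\{\mathcal F_t\}$, increments after $t$ independent of $\mathcal F_t$); $\theta<0$, $\sigma>0$, $\gamma:=-2\theta/\sigma^2$; $\underline{\gamma}>0$ is a known constant with $\underline{\gamma}\le\gamma$. Assumption on $h:\mathbb R\to[0,\infty)$: (i) $h$ is continuous; $h$ is strictly increasing on $[0,\infty)$; $h$ is continuously differentiable on $(-\infty,0)$ with $h'(x)<0$ there; (ii) $\lim_{x\to-\infty}h(x)=+\infty$; (iii) there is a constant $0<b<\underline{\gamma}/2$ with $\limsup_{x\to+\infty}h(x)/e^{bx}<+\infty$. Reflected Brownian motion. For $s\ge 0$ and $\mathcal F_s$-measurable (possibly random) $r$ and $y\ge r$, $(Z_r^{s,y},Y_r^{s,y})$ is the unique continuous adapted pair on $[s,\infty)$ with $Z_r^{s,y}(t)=y+\theta(t-s)+\sigma(B(t)-B(s))+Y_r^{s,y}(t)\ge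 r$, $Y_r^{s,y}$ nondecreasing, $Y_r^{s,y}(s)=0$, $\int_s^t\mathbf 1_{\{Z_r^{s,y}(u)>r\}}\,dY_r^{s,y}(u)=0$ for $t\ge s$. Write $Z_r:=Z_r^{0,x}$, where $x$ is the initial state; $\mathbb E_x$ is expectation with initial state $x$. Cost. $C(u,r):=u\int_r^\infty h(z)e^{-u(z-r)}\,dz$ and $F(u,r):=C(u,r)-h(r)$. For each $u\ge\underline{\gamma}$ the equation $F(u,r)=0$ has a unique solution $r\in\mathbb R$, which is negative; it is denoted $r(u)$. $r^*:=r(\gamma)$. Constants. $K_h>0$ is a constant such that $r(u)\in(-K_h,0)$ for all $u\ge\underline{\gamma}$ (such a constant exists). $a>0$ is such that $h(x)\le ae^{bx}$ for $x\ge0$, $H_K>0$ is such that $h(x)\le H_K$ for $-K_h\le x\le 0$, and $C_h:=\max\{a,H_K\}$. AU algorithm. Let $\tau_k:=2^k-1$, $\Delta\tau_k:=2^k$, $k\ge0$. Set $\hat r_0:=0$, $X_0:=x$. Recursively for $k\ge 0$: on $[\tau_k,\tau_{k+1})$ set $Z^{\mathrm{AU}}(t):=Z^{\tau_k,X_k}_{\hat r_k}(t)$; then $\hat\gamma_{k+1}:=\max\{(\frac1{\Delta\tau_k}\int_{\tau_k}^{\tau_{k+1}}(Z^{\mathrm{AU}}(s)-\hat r_k)\,ds)^{-1},\underline{\gamma}\}$, $\hat r_{k+1}:=r(\hat\gamma_{k+1})$, $X_{k+1}:=\max\{Z^{\mathrm{AU}}(\tau_{k+1}-),\hat r_{k+1}\}$.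 AU-FH algorithm. Same construction with $\tilde r_k,\tilde X_k,Z^{\mathrm{AU\text{-}FH}}$ in place of $\hat r_k,X_k,Z^{\mathrm{AU}}$ (with $\tilde r_0=0$, $\tilde X_0=x$, $\tilde r_{k+1}:=r(\tilde\gamma_{k+1})$), but with $\tilde\gamma_{k+1}:=\max\{(\frac1{\tau_{k+1}}\sum_{i=0}^k\int_{\tau_i}^{\tau_{i+1}}(Z^{\mathrm{AU\text{-}FH}}(s)-\tilde r_i)\,ds)^{-1},\underline{\gamma}\}$. Transient regret terms. For $T\ge1$ let $N:=\lfloor\log_2(T+1)\rfloor$, so $\tau_N\le T<\tau_{N+1}$. $R_1^{\mathrm{AU}}:=\mathbb E_x[\sum_{k=0}^{N-1}\int_{\tau_k}^{\tau_{k+1}}(h(Z^{\tau_k,X_k}_{\hat r_k}(t))-C(\gamma,\hat r_k))\,dt]+\mathbb E_x[\int_{\tau_N}^T(h(Z^{\tau_N,X_N}_{\hat r_N}(t))-C(\gamma,\hat r_N))\,dt]$; $R_4^{\mathrm{AU}}:=\mathbb E_x[\int_0^T(C(\gamma,r^* )-h(Z_{r^*}(t)))\,dt]$. $R_1^{\mathrm{AU\text{-}FH}}$ and $R_4^{\mathrm{AU\text{-}FH}}$ are obtained by replacing $\hat r_k,X_k$ with $\tilde r_k,\tilde X_k$. *)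

theory Defs
  imports "HOL-Probability.Probability"
begin

definition filtered_prob_space :: "'a measure \<Rightarrow> (real \<Rightarrow> 'a measure) \<Rightarrow> bool" where
  "filtered_prob_space M F \<longleftrightarrow>
     prob_space M \<and>
     (\<forall>t\<ge>0. subalgebra M (F t)) \<and>
     (\<forall>s t. 0 \<le> s \<and> s \<le> t \<longrightarrow> subalgebra (F t) (F s))"

definition standard_BM ::
    "'a measure \<Rightarrow> (real \<Rightarrow> 'a measure) \<Rightarrow> (real \<Rightarrow> 'a \<Rightarrow> real) \<Rightarrow> bool" where
  "standard_BM M F B \<longleftrightarrow>
     filtered_prob_space M F \<and>
     (\<forall>t\<ge>0. B t \<in> borel_measurable (F t)) \<and>
     (AE \<omega> in M. B 0 \<omega> = 0) \<and>
     (\<forall>\<omega>\<in>space M. continuous_on {0..} (\<lambda>t. B t \<omega>)) \<and>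
     (\<forall>s t. 0 \<le> s \<and> s < t \<longrightarrow>
        distributed M lborel (\<lambda>\<omega>. B t \<omega> - B s \<omega>) (normal_density 0 (sqrt (t - s))) \<and>
        prob_space.indep_set M (sets (F s))
          {(\<lambda>\<omega>. B t \<omega> - B s \<omega>) -` A \<inter> space M | A. A \<in> sets borel})"

text \<open>The predicate says that \<open>(Z, Y)\<close> is the pair $(Z_r^{s,y}, Y_r^{s,y})$ on $[s,\infty)$, the
  reflecting barrier \<open>r\<close> and the starting point \<open>y\<close> being random variables.
  Values of \<open>Z\<close> and \<open>Y\<close> at times before \<open>s\<close> are irrelevant. Since \<open>interval_measure\<close>
  needs a function on the whole line, \<open>Y\<close> is extended constantly to the left of \<open>s\<close>.\<close>

definition reflected_BM ::
    "(real \<Rightarrow> 'a measure) \<Rightarrow> (real \<Rightarrow> 'a \<Rightarrow> real) \<Rightarrow> real \<Rightarrow> real \<Rightarrow> real \<Rightarrow>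
     ('a \<Rightarrow> real) \<Rightarrow> ('a \<Rightarrow> real) \<Rightarrow> (real \<Rightarrow> 'a \<Rightarrow> real) \<Rightarrow> (real \<Rightarrow> 'a \<Rightarrow> real) \<Rightarrow> bool" where
  "reflected_BM F B \<theta> \<sigma> s r y Z Y \<longleftrightarrow>
     0 \<le> s \<and>
     r \<in> borel_measurable (F s) \<and> y \<in> borel_measurable (F s) \<and>
     (\<forall>t\<ge>s. Z t \<in> borel_measurable (F t) \<and> Y t \<in> borel_measurable (F t)) \<and>
     (\<forall>\<omega>\<in>space (F s).
        r \<omega> \<le> y \<omega> \<and>
        continuous_on {s..} (\<lambda>t. Z t \<omega>) \<and> continuous_on {s..} (\<lambda>t. Y t \<omega>) \<and>
        (\<forall>t\<ge>s. Z t \<omega> = y \<omega> + \<theta> * (t - s) + \<sigma> * (B t \<omega> - B s \<omega>) + Y t \<omega> \<and> Z t \<omega> \<ge> r \<omega>) \<and>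
        mono_on {s..} (\<lambda>t. Y t \<omega>) \<and> Y s \<omega> = 0 \<and>
        (\<forall>t\<ge>s. (LINT u:{s..t}|interval_measure (\<lambda>v. Y (max s v) \<omega>).
                    indicat_real {v. Z v \<omega> > r \<omega>} u) = 0))"

definition cost_assumption :: "(real \<Rightarrow> real) \<Rightarrow> real \<Rightarrow> real \<Rightarrow> bool" where
  "cost_assumption h \<gamma>min b \<longleftrightarrow>
     (\<forall>x. 0 \<le> h x) \<and>
     continuous_on UNIV h \<and> strict_mono_on {0..} h \<and>
     (\<forall>x<0. h field_differentiable at x) \<and> continuous_on {..<0} (deriv h) \<and>
     (\<forall>x<0. deriv h x < 0) \<and>
     filterlim h at_top at_bot \<and>
     0 < b \<and> b < \<gamma>min / 2 \<and>
     Limsup at_top (\<lambda>x. ereal (h x / exp (b * x))) < \<infinity>"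

definition cost_C :: "(real \<Rightarrow> real) \<Rightarrow> real \<Rightarrow> real \<Rightarrow> real" where
  "cost_C h u r = u * (LINT z:{r..}|lborel. h z * exp (- u * (z - r)))"

definition cost_F :: "(real \<Rightarrow> real) \<Rightarrow> real \<Rightarrow> real \<Rightarrow> real" where
  "cost_F h u r = cost_C h u r - h r"

definition r_opt :: "(real \<Rightarrow> real) \<Rightarrow> real \<Rightarrow> real" where
  "r_opt h u = (THE r. cost_F h u r = 0)"

definition \<tau> :: "nat \<Rightarrow> real" where
  "\<tau> k = 2 ^ k - 1"

definition \<Delta>\<tau> :: "nat \<Rightarrow> real" where
  "\<Delta>\<tau> k = 2 ^ k"

text \<open>The part of the construction shared by both algorithms. The process \<open>Z k\<close> is
  $Z^{\tau_k,X_k}_{r_k}$ on all of $[\tau_k,\infty)$, and \<open>W\<close> is the process obtained by concatenating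
  the pieces. The estimates \<open>g k\<close> of $\gamma$ are constrained only for \<open>k \<ge> 1\<close>, by
  the two predicates further below.\<close>

definition phase_scheme ::
    "'a measure \<Rightarrow> (real \<Rightarrow> 'a measure) \<Rightarrow> (real \<Rightarrow> 'a \<Rightarrow> real) \<Rightarrow> real \<Rightarrow> real \<Rightarrow>
     (real \<Rightarrow> real) \<Rightarrow> real \<Rightarrow>
     (nat \<Rightarrow> 'a \<Rightarrow> real) \<Rightarrow> (nat \<Rightarrow> 'a \<Rightarrow> real) \<Rightarrow> (nat \<Rightarrow> 'a \<Rightarrow> real) \<Rightarrow>
     (nat \<Rightarrow> real \<Rightarrow> 'a \<Rightarrow> real) \<Rightarrow> (nat \<Rightarrow> real \<Rightarrow> 'a \<Rightarrow> real) \<Rightarrow> (real \<Rightarrow> 'a \<Rightarrow> real) \<Rightarrow> bool" where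
  "phase_scheme M F B \<theta> \<sigma> h x g r X Z Y W \<longleftrightarrow>
     (\<forall>\<omega>\<in>space M. r 0 \<omega> = 0 \<and> X 0 \<omega> = x) \<and>
     (\<forall>k. reflected_BM F B \<theta> \<sigma> (\<tau> k) (r k) (X k) (Z k) (Y k)) \<and>
     (\<forall>k. \<forall>\<omega>\<in>space M.
        (\<forall>t\<in>{\<tau> k..<\<tau> (Suc k)}. W t \<omega> = Z k t \<omega>) \<and>
        r (Suc k) \<omega> = r_opt h (g (Suc k) \<omega>) \<and>
        X (Suc k) \<omega> = max (Lim (at_left (\<tau> (Suc k))) (\<lambda>t. W t \<omega>)) (r (Suc k) \<omega>))"

text \<open>In both estimators \<open>inverse 0 = 0\<close> yields the value \<open>\<gamma>min\<close> when the time average vanishes,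
  which happens with probability zero only.\<close>

definition AU_algorithm ::
    "'a measure \<Rightarrow> (real \<Rightarrow> 'a measure) \<Rightarrow> (real \<Rightarrow> 'a \<Rightarrow> real) \<Rightarrow> real \<Rightarrow> real \<Rightarrow>
     (real \<Rightarrow> real) \<Rightarrow> real \<Rightarrow> real \<Rightarrow>
     (nat \<Rightarrow> 'a \<Rightarrow> real) \<Rightarrow> (nat \<Rightarrow> 'a \<Rightarrow> real) \<Rightarrow> (nat \<Rightarrow> 'a \<Rightarrow> real) \<Rightarrow>
     (nat \<Rightarrow> real \<Rightarrow> 'a \<Rightarrow> real) \<Rightarrow> (nat \<Rightarrow> real \<Rightarrow> 'a \<Rightarrow> real) \<Rightarrow> (real \<Rightarrow> 'a \<Rightarrow> real) \<Rightarrow> bool" where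
  "AU_algorithm M F B \<theta> \<sigma> h \<gamma>min x g r X Z Y W \<longleftrightarrow>
     phase_scheme M F B \<theta> \<sigma> h x g r X Z Y W \<and>
     (\<forall>k. \<forall>\<omega>\<in>space M.
        g (Suc k) \<omega> =
          max (inverse (1 / \<Delta>\<tau> k *
                 (LINT s:{\<tau> k..<\<tau> (Suc k)}|lborel. W s \<omega> - r k \<omega>))) \<gamma>min)"

definition AU_FH_algorithm ::
    "'a measure \<Rightarrow> (real \<Rightarrow> 'a measure) \<Rightarrow> (real \<Rightarrow> 'a \<Rightarrow> real) \<Rightarrow> real \<Rightarrow> real \<Rightarrow>
     (real \<Rightarrow> real) \<Rightarrow> real \<Rightarrow> real \<Rightarrow>
     (nat \<Rightarrow> 'a \<Rightarrow> real) \<Rightarrow> (nat \<Rightarrow> 'a \<Rightarrow> real) \<Rightarrow> (nat \<Rightarrow> 'a \<Rightarrow> real) \<Rightarrow>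
     (nat \<Rightarrow> real \<Rightarrow> 'a \<Rightarrow> real) \<Rightarrow> (nat \<Rightarrow> real \<Rightarrow> 'a \<Rightarrow> real) \<Rightarrow> (real \<Rightarrow> 'a \<Rightarrow> real) \<Rightarrow> bool" where
  "AU_FH_algorithm M F B \<theta> \<sigma> h \<gamma>min x g r X Z Y W \<longleftrightarrow>
     phase_scheme M F B \<theta> \<sigma> h x g r X Z Y W \<and>
     (\<forall>k. \<forall>\<omega>\<in>space M.
        g (Suc k) \<omega> =
          max (inverse (1 / \<tau> (Suc k) *
                 (\<Sum>i=0..k. LINT s:{\<tau> i..<\<tau> (Suc i)}|lborel. W s \<omega> - r i \<omega>))) \<gamma>min)"

definition phase_count :: "real \<Rightarrow> nat" where
  "phase_count T = nat \<lfloor>log 2 (T + 1)\<rfloor>"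

definition regret_R1 ::
    "'a measure \<Rightarrow> (real \<Rightarrow> real) \<Rightarrow> real \<Rightarrow> real \<Rightarrow>
     (nat \<Rightarrow> 'a \<Rightarrow> real) \<Rightarrow> (nat \<Rightarrow> real \<Rightarrow> 'a \<Rightarrow> real) \<Rightarrow> real" where
  "regret_R1 M h \<gamma> T r Z =
     (let N = phase_count T in
       (\<integral>\<omega>. (\<Sum>k<N. LINT t:{\<tau> k..\<tau> (Suc k)}|lborel. h (Z k t \<omega>) - cost_C h \<gamma> (r k \<omega>)) \<partial>M) +
       (\<integral>\<omega>. (LINT t:{\<tau> N..T}|lborel. h (Z N t \<omega>) - cost_C h \<gamma> (r N \<omega>)) \<partial>M))"

text \<open>\<open>Zs\<close> stands for $Z_{r^*}$ with $r^* = r(\gamma)$. This term does not depend on the output of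
  either algorithm.\<close>

definition regret_R4 ::
    "'a measure \<Rightarrow> (real \<Rightarrow> real) \<Rightarrow> real \<Rightarrow> real \<Rightarrow> (real \<Rightarrow> 'a \<Rightarrow> real) \<Rightarrow> real" where
  "regret_R4 M h \<gamma> T Zs =
     (\<integral>\<omega>. (LINT t:{0..T}|lborel. cost_C h \<gamma> (r_opt h \<gamma>) - h (Zs t \<omega>)) \<partial>M)"

end

theory Submission
  imports Defs "HOL-Real_Asymp.Real_Asymp"
begin

text \<open>
  Put \<open>l = \<gamma>min / 2\<close> and \<open>c = \<sigma>\<^sup>2 * l * (\<gamma> - l) / 2\<close>, so that \<open>E exp (l * W) = exp (- c * t)\<close> for an
  increment \<open>W\<close> of the free process over time \<open>t\<close>. Two reflected processes that are driven by the same
  noise differ at time \<open>t\<close> only if the larger one has not been reflected; hence their expected costs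
  differ by at most \<open>Ch * exp (- c * t) * E exp (l * max v v')\<close>, where \<open>v, v'\<close> are the initial
  distances from the barrier. Starting one of them from the stationary law \<open>Exp(\<gamma>)\<close>, for which
  \<open>E exp (l * v') \<le> 2\<close> and the expected cost is \<open>C(\<gamma>, r)\<close>, and integrating over time bounds every
  phase by \<open>Ch / c * (2 + E exp (l * v))\<close>. Since all barriers are at most \<open>0\<close>, the state at the start of
  a phase is dominated by the process started from \<open>x\<close> and reflected at \<open>0\<close>, whose exponential moment
  is at most \<open>4 + exp (l * x)\<close>; there are at most \<open>log 2 T + 2\<close> phases.

  No stochastic calculus is used: the reflected process is the limit of random walks reflected on
  equidistant grids. Stationarity of \<open>Exp(\<gamma>)\<close> holds only in the limit: its tail \<open>exp (- \<gamma> * a)\<close> is a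
  supersolution of the one-step tail equation, and \<open>exp (- \<gamma> * (a + e))\<close> is a subsolution up to the
  term \<open>E (exp (\<gamma> * W); W > e)\<close>, which is negligible even after summation over the grid.
\<close>

subsection \<open>Auxiliary facts on integrals and limits\<close>

text \<open>Completing the square: tilting by \<open>exp (k * w)\<close> moves the mean to
  \<open>m + k * s\<^sup>2\<close> and leaves a constant factor.\<close>

lemma nn_integral_exp_normal:
  fixes k m s :: real
  assumes s: "0 < s"
  shows "(\<integral>\<^sup>+w. ennreal (exp (k * w)) \<partial>density lborel (normal_density m s))
    = ennreal (exp (k * m + k\<^sup>2 * s\<^sup>2 / 2))"
proof -
  have eq: "normal_density m s w * exp (k * w)
      = exp (k * m + k\<^sup>2 * s\<^sup>2 / 2) * normal_density (m + k * s\<^sup>2) s w" for w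
  proof -
    have "- (w - m)\<^sup>2 / (2 * s\<^sup>2) + k * w
        = k * m + k\<^sup>2 * s\<^sup>2 / 2 + - (w - (m + k * s\<^sup>2))\<^sup>2 / (2 * s\<^sup>2)"
      using s by (simp add: field_simps power2_eq_square)
    then have "exp (- (w - m)\<^sup>2 / (2 * s\<^sup>2)) * exp (k * w)
        = exp (k * m + k\<^sup>2 * s\<^sup>2 / 2) * exp (- (w - (m + k * s\<^sup>2))\<^sup>2 / (2 * s\<^sup>2))"
      by (simp only: exp_add [symmetric])
    then show ?thesis
      by (simp add: normal_density_def)
  qed
  interpret prob_space "density lborel (normal_density (m + k * s\<^sup>2) s)"
    by (rule prob_space_normal_density [OF s])
  have "(\<integral>\<^sup>+w. ennreal (exp (k * w)) \<partial>density lborel (normal_density m s))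
      = (\<integral>\<^sup>+w. ennreal (exp (k * m + k\<^sup>2 * s\<^sup>2 / 2)) * ennreal (normal_density (m + k * s\<^sup>2) s w) \<partial>lborel)"
    by (subst nn_integral_density)
       (simp_all add: ennreal_mult' [symmetric] eq)
  also have "\<dots> = ennreal (exp (k * m + k\<^sup>2 * s\<^sup>2 / 2)) * (\<integral>\<^sup>+w. ennreal (normal_density (m + k * s\<^sup>2) s w) \<partial>lborel)"
    by (simp add: nn_integral_cmult)
  also have "(\<integral>\<^sup>+w. ennreal (normal_density (m + k * s\<^sup>2) s w) \<partial>lborel) = 1"
    using emeasure_space_1 by (simp add: emeasure_density)
  finally show ?thesis by simp
qed

text \<open>Fatou's lemma: a uniform bound on the integrals passes to a pointwise limit without a
  dominating function.\<close>

lemma nn_integral_tendsto_le: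
  assumes "\<And>n. u n \<in> borel_measurable M"
    and "\<And>x. x \<in> space M \<Longrightarrow> (\<lambda>n. u n x) \<longlonglongrightarrow> v x"
    and "\<And>n. (\<integral>\<^sup>+x. u n x \<partial>M) \<le> (c :: ennreal)"
  shows "(\<integral>\<^sup>+x. v x \<partial>M) \<le> c"
proof -
  have "(\<integral>\<^sup>+x. v x \<partial>M) = (\<integral>\<^sup>+x. liminf (\<lambda>n. u n x) \<partial>M)"
    by (intro nn_integral_cong lim_imp_Liminf [symmetric] assms(2)) simp_all
  also have "\<dots> \<le> liminf (\<lambda>n. \<integral>\<^sup>+x. u n x \<partial>M)"
    by (intro nn_integral_liminf assms(1))
  also have "\<dots> \<le> c"
    using assms(3) by (intro Liminf_le) (auto intro!: always_eventually)
  finally show ?thesis .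
qed

text \<open>Interchange of limits: \<open>k\<close> is a truncation level whose error is uniform in
  \<open>n\<close>.\<close>

lemma tendsto_uniform_approx:
  fixes x :: "nat \<Rightarrow> real" and J :: "nat \<Rightarrow> nat \<Rightarrow> real"
  assumes J: "\<And>k. (\<lambda>n. J n k) \<longlonglongrightarrow> J' k"
    and x: "\<And>n k. \<bar>x n - J n k\<bar> \<le> D / Suc k" and x': "\<And>k. \<bar>x' - J' k\<bar> \<le> D / Suc k"
  shows "x \<longlonglongrightarrow> x'"
proof (rule LIMSEQ_I)
  fix e :: real assume "0 < e"
  have "(\<lambda>k. D / Suc k) \<longlonglongrightarrow> 0"
    by (rule LIMSEQ_Suc [OF lim_const_over_n])
  then have "eventually (\<lambda>k. D / Suc k < e / 3) sequentially"
    using \<open>0 < e\<close> by (intro order_tendstoD) auto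
  then obtain k where k: "D / Suc k < e / 3"
    by (auto simp: eventually_sequentially)
  obtain N where N: "\<And>n. n \<ge> N \<Longrightarrow> norm (J n k - J' k) < e / 3"
    using LIMSEQ_D [OF J [of k], of "e / 3"] \<open>0 < e\<close> by auto
  have "norm (x n - x') < e" if "n \<ge> N" for n
    using N [OF that] x [of n k] x' [of k] k unfolding real_norm_def by linarith
  then show "\<exists>N. \<forall>n\<ge>N. norm (x n - x') < e" by blast
qed

text \<open>Rounding time down to the grid of mesh \<open>1 / Suc n\<close> and continuity give
  joint measurability, as Fubini over time and \<open>M\<close> requires. \<open>max s\<close>
  freezes the path before \<open>s\<close>, where nothing is known about \<open>Z\<close>.\<close>

lemma borel_measurable_continuous_process:
  fixes Z :: "real \<Rightarrow> 'a \<Rightarrow> real"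
  assumes Z: "\<And>t. s \<le> t \<Longrightarrow> Z t \<in> borel_measurable M"
    and cont: "\<And>\<omega>. \<omega> \<in> space M \<Longrightarrow> continuous_on {s..} (\<lambda>t. Z t \<omega>)"
  shows "(\<lambda>p. Z (max s (fst p)) (snd p)) \<in> borel_measurable (borel \<Otimes>\<^sub>M M)"
proof (rule borel_measurable_LIMSEQ_real)
  let ?k = "\<lambda>n u. nat \<lfloor>(max s u - s) * Suc n\<rfloor>"
  fix n :: nat
  show "(\<lambda>p. Z (s + ?k n (fst p) / Suc n) (snd p)) \<in> borel_measurable (borel \<Otimes>\<^sub>M M)"
  \<comment> \<open>The rounded time takes only countably many values.\<close>
  proof (rule measurable_compose_countable [where f = "\<lambda>k p. Z (s + real k / Suc n) (snd p)"])
    show "(\<lambda>p. Z (s + real k / Suc n) (snd p)) \<in> borel_measurable (borel \<Otimes>\<^sub>M M)" for k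
      by (rule measurable_compose [OF measurable_snd Z]) simp
    show "(\<lambda>p. ?k n (fst p)) \<in> borel \<Otimes>\<^sub>M M \<rightarrow>\<^sub>M count_space UNIV"
      by measurable
  qed
next
  let ?k = "\<lambda>n u. nat \<lfloor>(max s u - s) * Suc n\<rfloor>"
  fix p :: "real \<times> 'a" assume "p \<in> space (borel \<Otimes>\<^sub>M M)"
  then have \<omega>: "snd p \<in> space M"
    by (auto simp: space_pair_measure)
  define m where "m = max s (fst p)"
  have m: "s \<le> m" by (simp add: m_def)
  have close: "\<bar>s + real (nat \<lfloor>(m - s) * Suc n\<rfloor>) / Suc n - m\<bar> \<le> 1 / Suc n" for n
  proof -
    have "0 \<le> (m - s) * Suc n"
      using m by simp
    then have "\<bar>real (nat \<lfloor>(m - s) * Suc n\<rfloor>) - (m - s) * Suc n\<bar> \<le> 1"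
      by linarith
    then have "\<bar>real (nat \<lfloor>(m - s) * Suc n\<rfloor>) - (m - s) * Suc n\<bar> / Suc n \<le> 1 / Suc n"
      by (intro divide_right_mono) auto
    moreover have "s + real (nat \<lfloor>(m - s) * Suc n\<rfloor>) / Suc n - m = (real (nat \<lfloor>(m - s) * Suc n\<rfloor>) - (m - s) * Suc n) / Suc n"
      by (simp add: diff_divide_distrib del: of_nat_Suc)
    then have "\<bar>s + real (nat \<lfloor>(m - s) * Suc n\<rfloor>) / Suc n - m\<bar> = \<bar>real (nat \<lfloor>(m - s) * Suc n\<rfloor>) - (m - s) * Suc n\<bar> / Suc n"
      by (simp only: abs_divide abs_of_nat)
    ultimately show ?thesis by simp
  qed
  have "(\<lambda>n. 1 / Suc n) \<longlonglongrightarrow> (0 :: real)"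
    by (rule LIMSEQ_Suc [OF lim_const_over_n])
  then have "(\<lambda>n. s + real (nat \<lfloor>(m - s) * Suc n\<rfloor>) / Suc n - m) \<longlonglongrightarrow> 0"
    by (rule Lim_null_comparison [rotated]) (simp add: close del: of_nat_Suc)
  then have lim: "(\<lambda>n. s + real (nat \<lfloor>(m - s) * Suc n\<rfloor>) / Suc n) \<longlonglongrightarrow> m"
    by (rule LIM_zero_cancel)
  have "(\<lambda>n. Z (s + real (nat \<lfloor>(m - s) * Suc n\<rfloor>) / Suc n) (snd p)) \<longlonglongrightarrow> Z m (snd p)"
    by (rule continuous_on_tendsto_compose [OF cont [OF \<omega>] lim]) (use m in simp_all)
  then show "(\<lambda>n. Z (s + ?k n (fst p) / Suc n) (snd p)) \<longlonglongrightarrow> Z (max s (fst p)) (snd p)"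
    by (simp only: m_def)
qed

subsection \<open>The reflected Gaussian random walk\<close>

text \<open>Transition operator of the Lindley recursion with step law \<open>\<mu>\<close>;
  \<open>reflect_law\<close> is its dual action on laws of the state.\<close>

definition reflect_op :: "real measure \<Rightarrow> (real \<Rightarrow> ennreal) \<Rightarrow> real \<Rightarrow> ennreal" where
  "reflect_op \<mu> f v = (\<integral>\<^sup>+w. f (max (v + w) 0) \<partial>\<mu>)"

definition reflect_law :: "real measure \<Rightarrow> real measure \<Rightarrow> real measure" where
  "reflect_law \<mu> \<nu> = distr (\<nu> \<Otimes>\<^sub>M \<mu>) borel (\<lambda>(v, w). max (v + w) 0)"

locale drifted_BM =
  fixes \<theta> \<sigma> \<gamma> :: real
  assumes theta_neg: "\<theta> < 0" and sigma_pos: "0 < \<sigma>" and gamma_eq: "\<gamma> = - 2 * \<theta> / \<sigma>\<^sup>2"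
begin

lemma gamma_pos: "0 < \<gamma>"
  using theta_neg sigma_pos by (simp add: gamma_eq divide_neg_pos)

lemma theta_eq: "\<theta> = - \<gamma> * \<sigma>\<^sup>2 / 2"
  using sigma_pos by (simp add: gamma_eq)

text \<open>For \<open>\<delta> > 0\<close> the law of one step of the free process
  \<open>\<theta> * t + \<sigma> * B t\<close> over a time \<open>\<delta>\<close>.\<close>

definition gauss :: "real \<Rightarrow> real measure" where
  "gauss \<delta> = density lborel (normal_density (\<theta> * \<delta>) (\<sigma> * sqrt \<delta>))"

text \<open>Negative logarithm of the moment generating function of the free increment per unit
  time. It vanishes at \<open>0\<close> and \<open>\<gamma>\<close> and is positive in between; the
  root \<open>\<gamma>\<close> is why the exponential law of rate \<open>\<gamma>\<close>
  appears.\<close>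

definition rate :: "real \<Rightarrow> real" where
  "rate l = \<sigma>\<^sup>2 * l * (\<gamma> - l) / 2"

lemma sets_gauss [simp, measurable_cong]: "sets (gauss \<delta>) = sets borel"
  by (simp add: gauss_def)

lemma space_gauss [simp]: "space (gauss \<delta>) = UNIV"
  by (simp add: gauss_def)

lemma prob_space_gauss: "0 < \<delta> \<Longrightarrow> prob_space (gauss \<delta>)"
  using sigma_pos by (simp add: gauss_def prob_space_normal_density)

lemma nn_integral_exp_gauss:
  assumes "0 < \<delta>"
  shows "(\<integral>\<^sup>+w. ennreal (exp (k * w)) \<partial>gauss \<delta>) = ennreal (exp (- rate k * \<delta>))"
proof -
  have "k * (\<theta> * \<delta>) + k\<^sup>2 * (\<sigma> * sqrt \<delta>)\<^sup>2 / 2 = - rate k * \<delta>"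
    using assms by (simp add: theta_eq rate_def power_mult_distrib field_simps power2_eq_square)
  then show ?thesis
    using assms sigma_pos nn_integral_exp_normal [of "\<sigma> * sqrt \<delta>" _ k] by (simp add: gauss_def)
qed

lemma nn_integral_exp_gauss_shift:
  assumes "0 < \<delta>"
  shows "(\<integral>\<^sup>+w. ennreal (exp (c + k * w)) \<partial>gauss \<delta>) = ennreal (exp (c - rate k * \<delta>))"
proof -
  have "(\<integral>\<^sup>+w. ennreal (exp (c + k * w)) \<partial>gauss \<delta>) = ennreal (exp c) * (\<integral>\<^sup>+w. ennreal (exp (k * w)) \<partial>gauss \<delta>)"
    by (simp add: exp_add ennreal_mult' nn_integral_cmult)
  then show ?thesis
    by (simp add: nn_integral_exp_gauss [OF assms] ennreal_mult' [symmetric] exp_add [symmetric])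
qed

subsection \<open>Contraction of the reflected random walk\<close>

abbreviation P :: "real \<Rightarrow> (real \<Rightarrow> ennreal) \<Rightarrow> real \<Rightarrow> ennreal" where
  "P \<delta> \<equiv> reflect_op (gauss \<delta>)"

text \<open>The parameter \<open>r\<close> will be instantiated by the random barrier, so
  measurability is needed jointly in barrier and state.\<close>

lemma measurable_reflect_op_param:
  assumes "0 < \<delta>" and "(\<lambda>(r, v). f r v) \<in> borel_measurable (borel \<Otimes>\<^sub>M borel)"
  shows "(\<lambda>(r, v). P \<delta> (f r) v) \<in> borel_measurable (borel \<Otimes>\<^sub>M borel)"
proof -
  interpret prob_space "gauss \<delta>" by (rule prob_space_gauss [OF assms(1)])
  note assms(2) [measurable]
  show ?thesis
    unfolding reflect_op_def by measurable
qed

lemma measurable_reflect_op: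
  assumes "0 < \<delta>" and [measurable]: "f \<in> borel_measurable borel"
  shows "P \<delta> f \<in> borel_measurable borel"
proof -
  interpret prob_space "gauss \<delta>" by (rule prob_space_gauss [OF assms(1)])
  show ?thesis
    unfolding reflect_op_def by measurable
qed

lemma measurable_funpow_reflect_op:
  assumes "0 < \<delta>" and "f \<in> borel_measurable borel"
  shows "(P \<delta> ^^ n) f \<in> borel_measurable borel"
  using assms by (induction n) (auto intro: measurable_reflect_op)

text \<open>Walks started at \<open>v\<close> and \<open>v'\<close> and driven by the same noise differ after one step only if
  the larger one is not reflected, so the bound picks up just the factor \<open>E exp (l * \<xi>)\<close>.\<close>

lemma reflect_op_osc:
  assumes \<delta>: "0 < \<delta>" and l: "0 < l" and A: "0 \<le> A" and f: "f \<in> borel_measurable borel"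
    and osc: "\<And>v v'. 0 \<le> v \<Longrightarrow> 0 \<le> v' \<Longrightarrow> f v \<le> f v' + ennreal (A * exp (l * max v v'))"
    and v: "0 \<le> v" "0 \<le> v'"
  shows "P \<delta> f v \<le> P \<delta> f v' + ennreal (A * exp (- rate l * \<delta>) * exp (l * max v v'))"
proof -
  note f [measurable]
  have "f (max (v + w) 0) \<le> f (max (v' + w) 0) + ennreal A * ennreal (exp (l * max v v' + l * w))" for w
  proof (cases "max v v' + w \<le> 0")
    case True
    then have "max (v + w) 0 = 0" "max (v' + w) 0 = 0" by auto
    then show ?thesis by simp
  next
    case False
    then have "max (max (v + w) 0) (max (v' + w) 0) = max v v' + w" by auto
    with osc [of "max (v + w) 0" "max (v' + w) 0"] show ?thesis
      using A by (simp add: ennreal_mult' distrib_left)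
  qed
  then have "P \<delta> f v \<le> (\<integral>\<^sup>+w. f (max (v' + w) 0) + ennreal A * ennreal (exp (l * max v v' + l * w)) \<partial>gauss \<delta>)"
    unfolding reflect_op_def by (intro nn_integral_mono) auto
  also have "\<dots> = P \<delta> f v' + ennreal A * ennreal (exp (l * max v v' - rate l * \<delta>))"
    by (simp add: reflect_op_def nn_integral_add nn_integral_cmult nn_integral_exp_gauss_shift [OF \<delta>])
  also have "ennreal A * ennreal (exp (l * max v v' - rate l * \<delta>)) = ennreal (A * exp (- rate l * \<delta>) * exp (l * max v v'))"
    using A by (simp add: ennreal_mult' [symmetric] exp_diff exp_minus field_simps)
  finally show ?thesis .
qed

text \<open>The one-step bound reproduces its own hypothesis with
  \<open>A * exp (- rate l * \<delta>)\<close> in place of \<open>A\<close>, so the factors multiply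
  up.\<close>

lemma funpow_reflect_op_osc:
  assumes \<delta>: "0 < \<delta>" and l: "0 < l" and A: "0 \<le> A" and f: "f \<in> borel_measurable borel"
    and osc: "\<And>v v'. 0 \<le> v \<Longrightarrow> 0 \<le> v' \<Longrightarrow> f v \<le> f v' + ennreal (A * exp (l * max v v'))"
    and v: "0 \<le> v" "0 \<le> v'"
  shows "(P \<delta> ^^ n) f v \<le> (P \<delta> ^^ n) f v' + ennreal (A * exp (- rate l * (n * \<delta>)) * exp (l * max v v'))"
  using v
proof (induction n arbitrary: v v')
  case 0
  then show ?case using osc by simp
next
  case (Suc n)
  have "P \<delta> ((P \<delta> ^^ n) f) v \<le> P \<delta> ((P \<delta> ^^ n) f) v'
      + ennreal (A * exp (- rate l * (n * \<delta>)) * exp (- rate l * \<delta>) * exp (l * max v v'))"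
    using A Suc.prems
    by (intro reflect_op_osc \<delta> l measurable_funpow_reflect_op f Suc.IH) auto
  also have "A * exp (- rate l * (n * \<delta>)) * exp (- rate l * \<delta>) = A * exp (- rate l * (Suc n * \<delta>))"
    by (simp add: exp_add [symmetric] algebra_simps)
  finally show ?case by simp
qed

subsection \<open>The exponential law is asymptotically invariant\<close>

abbreviation expo :: "real measure" where
  "expo \<equiv> density lborel (exponential_density \<gamma>)"

text \<open>Law after \<open>n\<close> steps of the reflected walk whose starting point has the law
  \<open>expo\<close>.\<close>

definition nu :: "real \<Rightarrow> nat \<Rightarrow> real measure" where
  "nu \<delta> n = (reflect_law (gauss \<delta>) ^^ n) expo"

lemma nu_0 [simp]: "nu \<delta> 0 = expo"
  by (simp add: nu_def)

lemma nu_Suc: "nu \<delta> (Suc n) = reflect_law (gauss \<delta>) (nu \<delta> n)"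
  by (simp add: nu_def)

lemma sets_nu [simp, measurable_cong]: "sets (nu \<delta> n) = sets borel"
  by (cases n) (simp_all add: nu_Suc reflect_law_def)

lemma space_nu [simp]: "space (nu \<delta> n) = UNIV"
  using sets_eq_imp_space_eq [OF sets_nu [of \<delta> n]] by simp

lemma prob_space_nu: "0 < \<delta> \<Longrightarrow> prob_space (nu \<delta> n)"
proof (induction n)
  case 0
  then show ?case using gamma_pos by (simp add: prob_space_exponential_density)
next
  case (Suc n)
  then interpret pair_prob_space "nu \<delta> n" "gauss \<delta>"
    by (simp add: pair_prob_space_def pair_sigma_finite_def prob_space_gauss prob_space_imp_sigma_finite)
  show ?case
    unfolding nu_Suc reflect_law_def by (intro P.prob_space_distr) measurable
qed

text \<open>Both orders of Fubini are wanted: integrating over the state first yields the tail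
  recursion, integrating over the noise first the duality with \<open>P\<close>.\<close>

lemma nn_integral_nu_Suc:
  assumes \<delta>: "0 < \<delta>" and f [measurable]: "f \<in> borel_measurable borel"
  shows "(\<integral>\<^sup>+v. f v \<partial>nu \<delta> (Suc n)) = (\<integral>\<^sup>+w. \<integral>\<^sup>+v. f (max (v + w) 0) \<partial>nu \<delta> n \<partial>gauss \<delta>)"
    and "(\<integral>\<^sup>+v. f v \<partial>nu \<delta> (Suc n)) = (\<integral>\<^sup>+v. P \<delta> f v \<partial>nu \<delta> n)"
proof -
  interpret pair_prob_space "nu \<delta> n" "gauss \<delta>"
    using \<delta> by (simp add: pair_prob_space_def pair_sigma_finite_def prob_space_gauss prob_space_nu prob_space_imp_sigma_finite)
  have eq: "(\<integral>\<^sup>+v. f v \<partial>nu \<delta> (Suc n)) = (\<integral>\<^sup>+(v, w). f (max (v + w) 0) \<partial>(nu \<delta> n \<Otimes>\<^sub>M gauss \<delta>))"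
    unfolding nu_Suc reflect_law_def by (subst nn_integral_distr) (auto simp: case_prod_beta' intro!: nn_integral_cong)
  show "(\<integral>\<^sup>+v. f v \<partial>nu \<delta> (Suc n)) = (\<integral>\<^sup>+w. \<integral>\<^sup>+v. f (max (v + w) 0) \<partial>nu \<delta> n \<partial>gauss \<delta>)"
    unfolding eq by (subst nn_integral_snd [symmetric]) auto
  show "(\<integral>\<^sup>+v. f v \<partial>nu \<delta> (Suc n)) = (\<integral>\<^sup>+v. P \<delta> f v \<partial>nu \<delta> n)"
    unfolding eq reflect_op_def by (subst M2.nn_integral_fst [symmetric]) auto
qed

text \<open>Duality: moving the steps from the law to the function lets pointwise bounds on
  \<open>(P \<delta> ^^ n) f\<close> be integrated against \<open>expo\<close>.\<close>

lemma nn_integral_nu: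
  assumes \<delta>: "0 < \<delta>" and f: "f \<in> borel_measurable borel"
  shows "(\<integral>\<^sup>+v. f v \<partial>nu \<delta> n) = (\<integral>\<^sup>+v. (P \<delta> ^^ n) f v \<partial>expo)"
  using f
proof (induction n arbitrary: f)
  case 0
  then show ?case by simp
next
  case (Suc n)
  have "(\<integral>\<^sup>+v. f v \<partial>nu \<delta> (Suc n)) = (\<integral>\<^sup>+v. P \<delta> f v \<partial>nu \<delta> n)"
    by (rule nn_integral_nu_Suc [OF \<delta> Suc.prems])
  also have "\<dots> = (\<integral>\<^sup>+v. (P \<delta> ^^ n) (P \<delta> f) v \<partial>expo)"
    by (intro Suc.IH measurable_reflect_op \<delta> Suc.prems)
  finally show ?case by (simp add: funpow_swap1)
qed

text \<open>The cut-off at 1 handles \<open>a < 0\<close>, a case that the tail recursion reaches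
  through the thresholds \<open>a - w\<close>.\<close>

lemma emeasure_expo_tail: "emeasure expo {a<..} = ennreal (min 1 (exp (- \<gamma> * a)))"
proof -
  interpret prob_space expo
    using gamma_pos by (rule prob_space_exponential_density)
  have d: "distributed expo lborel (\<lambda>x. x) (exponential_density \<gamma>)"
    by (simp add: distributed_def distr_id2)
  show ?thesis
  proof (cases "0 \<le> a")
    case True
    then have "prob {a<..} = exp (- a * \<gamma>)"
      using exponential_distributedD_gt [OF d True gamma_pos] by (simp add: greaterThan_def)
    moreover have "exp (- \<gamma> * a) \<le> 1"
      using True gamma_pos by simp
    ultimately show ?thesis
      by (simp add: emeasure_eq_measure mult.commute min_absorb2)
  next
    case False
    have "prob {0<..} = 1"
      using exponential_distributedD_gt [OF d order_refl gamma_pos] by (simp add: greaterThan_def)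
    moreover have "prob {0<..} \<le> prob {a<..}"
      using False by (intro finite_measure_mono) auto
    ultimately have "prob {a<..} = 1"
      using prob_le_1 [of "{a<..}"] by simp
    moreover have "1 \<le> exp (- \<gamma> * a)"
      using False gamma_pos by (simp add: mult_nonneg_nonpos)
    ultimately show ?thesis
      by (simp add: emeasure_eq_measure min_absorb1)
  qed
qed

text \<open>For \<open>0 \<le> a\<close> the reflected value exceeds \<open>a\<close> iff
  \<open>v > a - w\<close>; the reflection itself shows only in the value 1 below 0.\<close>

lemma emeasure_nu_Suc_tail:
  assumes \<delta>: "0 < \<delta>"
  shows "emeasure (nu \<delta> (Suc n)) {a<..}
    = (if 0 \<le> a then \<integral>\<^sup>+w. emeasure (nu \<delta> n) {a - w<..} \<partial>gauss \<delta> else 1)"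
proof (cases "0 \<le> a")
  case True
  have "emeasure (nu \<delta> (Suc n)) {a<..} = (\<integral>\<^sup>+v. indicator {a<..} v \<partial>nu \<delta> (Suc n))"
    by simp
  also have "\<dots> = (\<integral>\<^sup>+w. \<integral>\<^sup>+v. indicator {a<..} (max (v + w) 0) \<partial>nu \<delta> n \<partial>gauss \<delta>)"
    by (rule nn_integral_nu_Suc(1) [OF \<delta>]) simp
  also have "\<dots> = (\<integral>\<^sup>+w. \<integral>\<^sup>+v. indicator {a - w<..} v \<partial>nu \<delta> n \<partial>gauss \<delta>)"
    using True by (intro nn_integral_cong) (auto simp: indicator_def)
  finally show ?thesis using True by simp
next
  case False
  interpret G: prob_space "gauss \<delta>" by (rule prob_space_gauss [OF \<delta>])
  interpret N: prob_space "nu \<delta> n" by (rule prob_space_nu [OF \<delta>])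
  have "emeasure (nu \<delta> (Suc n)) {a<..} = (\<integral>\<^sup>+v. indicator {a<..} v \<partial>nu \<delta> (Suc n))"
    by simp
  also have "\<dots> = (\<integral>\<^sup>+w. \<integral>\<^sup>+v. indicator {a<..} (max (v + w) 0) \<partial>nu \<delta> n \<partial>gauss \<delta>)"
    by (rule nn_integral_nu_Suc(1) [OF \<delta>]) simp
  also have "\<dots> = (\<integral>\<^sup>+w. \<integral>\<^sup>+v. 1 \<partial>nu \<delta> n \<partial>gauss \<delta>)"
    using False by (intro nn_integral_cong) (auto simp: indicator_def)
  also have "\<dots> = 1"
    using N.emeasure_space_1 G.emeasure_space_1 by simp
  finally show ?thesis using False by simp
qed

text \<open>Since \<open>rate \<gamma> = 0\<close>, a free step preserves
  \<open>exp (- \<gamma> * a)\<close>, and dropping the cut-off at 1 inside the integral only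
  enlarges the integrand.\<close>

lemma nu_tail_le:
  assumes \<delta>: "0 < \<delta>"
  shows "emeasure (nu \<delta> n) {a<..} \<le> ennreal (min 1 (exp (- \<gamma> * a)))"
proof (induction n arbitrary: a)
  case 0
  then show ?case by (simp add: emeasure_expo_tail)
next
  case (Suc n)
  interpret N: prob_space "nu \<delta> (Suc n)" by (rule prob_space_nu [OF \<delta>])
  show ?case
  proof (cases "0 \<le> a")
    case True
    have "emeasure (nu \<delta> (Suc n)) {a<..} = (\<integral>\<^sup>+w. emeasure (nu \<delta> n) {a - w<..} \<partial>gauss \<delta>)"
      using True by (simp add: emeasure_nu_Suc_tail [OF \<delta>])
    also have "\<dots> \<le> (\<integral>\<^sup>+w. ennreal (exp (- \<gamma> * a + \<gamma> * w)) \<partial>gauss \<delta>)"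
      by (intro nn_integral_mono order_trans [OF Suc]) (auto simp: algebra_simps intro!: ennreal_leI)
    also have "\<dots> = ennreal (exp (- \<gamma> * a))"
      by (simp only: nn_integral_exp_gauss_shift [OF \<delta>]) (simp add: rate_def)
    also have "exp (- \<gamma> * a) = min 1 (exp (- \<gamma> * a))"
      using True gamma_pos by (simp add: min_absorb2)
    finally show ?thesis .
  next
    case False
    then have "1 \<le> exp (- \<gamma> * a)"
      using gamma_pos by (simp add: mult_nonneg_nonpos)
    then have "min 1 (exp (- \<gamma> * a)) = 1"
      by simp
    then show ?thesis
      using N.emeasure_le_1 by simp
  qed
qed

text \<open>Bounds the one-step defect of the tail shifted by \<open>e\<close>: only steps longer
  than \<open>e\<close> can push the threshold to where \<open>exp\<close> exceeds the cut-off
  1.\<close>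

definition overshoot :: "real \<Rightarrow> real \<Rightarrow> ennreal" where
  "overshoot \<delta> e = (\<integral>\<^sup>+w. ennreal (exp (\<gamma> * w)) * indicator {e<..} w \<partial>gauss \<delta>)"

text \<open>The shift leaves room: for \<open>w \<le> e\<close> and \<open>0 \<le> a\<close> the
  threshold \<open>a - w + e\<close> is nonnegative, so the cut-off is inactive and
  \<open>exp\<close> propagates exactly. Each step therefore loses at most one
  \<open>overshoot\<close>.\<close>

lemma nu_tail_ge:
  assumes \<delta>: "0 < \<delta>" and e: "0 < e"
  shows "ennreal (min 1 (exp (- \<gamma> * (a + e)))) \<le> emeasure (nu \<delta> n) {a<..} + of_nat n * overshoot \<delta> e"
proof (induction n arbitrary: a)
  case 0
  have "exp (- \<gamma> * (a + e)) \<le> exp (- \<gamma> * a)"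
    using e gamma_pos by simp
  then have "min 1 (exp (- \<gamma> * (a + e))) \<le> min 1 (exp (- \<gamma> * a))"
    by linarith
  then show ?case by (simp only: nu_0 emeasure_expo_tail of_nat_0 mult_zero_left add_0_right ennreal_leI)
next
  case (Suc n)
  interpret G: prob_space "gauss \<delta>" by (rule prob_space_gauss [OF \<delta>])
  show ?case
  proof (cases "0 \<le> a")
    case True
    have [measurable]: "(\<lambda>w. emeasure (nu \<delta> n) {a - w<..}) \<in> borel_measurable borel"
    proof -
      interpret N: prob_space "nu \<delta> n" by (rule prob_space_nu [OF \<delta>])
      have "(\<lambda>w. \<integral>\<^sup>+v. indicator {a - w<..} v \<partial>nu \<delta> n) \<in> borel_measurable borel"
        unfolding greaterThan_def by measurable
      then show ?thesis by simp
    qed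
    have "ennreal (min 1 (exp (- \<gamma> * (a + e)))) \<le> ennreal (exp (- \<gamma> * (a + e)))"
      by (intro ennreal_leI) simp
    also have "\<dots> = (\<integral>\<^sup>+w. ennreal (exp (- \<gamma> * (a + e) + \<gamma> * w)) \<partial>gauss \<delta>)"
      by (simp only: nn_integral_exp_gauss_shift [OF \<delta>]) (simp add: rate_def)
    also have "\<dots> \<le> (\<integral>\<^sup>+w. (emeasure (nu \<delta> n) {a - w<..} + of_nat n * overshoot \<delta> e)
        + ennreal (exp (\<gamma> * w)) * indicator {e<..} w \<partial>gauss \<delta>)"
    proof (intro nn_integral_mono)
      fix w
      show "ennreal (exp (- \<gamma> * (a + e) + \<gamma> * w))
        \<le> (emeasure (nu \<delta> n) {a - w<..} + of_nat n * overshoot \<delta> e) + ennreal (exp (\<gamma> * w)) * indicator {e<..} w"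
      proof (cases "e < w")
        case True
        have "exp (- \<gamma> * (a + e) + \<gamma> * w) \<le> exp (\<gamma> * w)"
          using gamma_pos e \<open>0 \<le> a\<close> by simp
        then show ?thesis
          using True by (auto intro!: ennreal_leI add_increasing)
      next
        case False
        have "\<gamma> * w \<le> \<gamma> * (a + e)"
          using False \<open>0 \<le> a\<close> gamma_pos by (intro mult_left_mono) auto
        then have "exp (- \<gamma> * (a + e) + \<gamma> * w) = min 1 (exp (- \<gamma> * ((a - w) + e)))"
          by (auto simp: algebra_simps min_def)
        then show ?thesis
          using False Suc.IH [of "a - w"] by simp
      qed
    qed
    also have "\<dots> = ((\<integral>\<^sup>+w. emeasure (nu \<delta> n) {a - w<..} \<partial>gauss \<delta>) + of_nat n * overshoot \<delta> e) + overshoot \<delta> e"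
      using G.emeasure_space_1 by (simp add: nn_integral_add overshoot_def)
    also have "\<dots> = emeasure (nu \<delta> (Suc n)) {a<..} + of_nat (Suc n) * overshoot \<delta> e"
      using True by (simp add: emeasure_nu_Suc_tail [OF \<delta>] algebra_simps)
    finally show ?thesis .
  next
    case False
    then show ?thesis
      by (simp add: emeasure_nu_Suc_tail [OF \<delta>] add_increasing2)
  qed
qed

text \<open>Chernoff bound: on \<open>w > e\<close> the factor \<open>exp (k * (w - e))\<close> is
  at least 1, and what remains is the Gaussian moment at \<open>\<gamma> + k\<close>.\<close>

lemma overshoot_le:
  assumes \<delta>: "0 < \<delta>" and k: "0 < k"
  shows "overshoot \<delta> e \<le> ennreal (exp (- k * e + \<sigma>\<^sup>2 * k * (\<gamma> + k) * \<delta> / 2))"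
proof -
  have "overshoot \<delta> e \<le> (\<integral>\<^sup>+w. ennreal (exp (- k * e + (\<gamma> + k) * w)) \<partial>gauss \<delta>)"
    unfolding overshoot_def using k
    by (intro nn_integral_mono) (auto simp: indicator_def algebra_simps intro!: ennreal_leI)
  also have "\<dots> = ennreal (exp (- k * e + \<sigma>\<^sup>2 * k * (\<gamma> + k) * \<delta> / 2))"
    by (simp only: nn_integral_exp_gauss_shift [OF \<delta>]) (simp add: rate_def field_simps)
  finally show ?thesis .
qed

lemma overshoot_tendsto_0:
  assumes t: "0 < t" and e: "0 < e"
  shows "(\<lambda>n. of_nat (Suc n) * overshoot (t / Suc n) e) \<longlonglongrightarrow> 0"
proof -
  \<comment> \<open>The choice \<open>k = sqrt (Suc n)\<close> keeps the quadratic term bounded, as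
    \<open>k\<^sup>2 * (t / Suc n) = t\<close>, while \<open>exp (- k * e)\<close> beats the factor
    \<open>Suc n\<close>.\<close>
  let ?u = "\<lambda>n :: nat. real (Suc n) * exp (- sqrt (Suc n) * e + \<sigma>\<^sup>2 * sqrt (Suc n) * (\<gamma> + sqrt (Suc n)) * (t / Suc n) / 2)"
  have "?u \<longlonglongrightarrow> 0"
    using t e gamma_pos sigma_pos by real_asymp
  then have lim: "(\<lambda>n. ennreal (?u n)) \<longlonglongrightarrow> 0"
    using tendsto_ennrealI by fastforce
  have "of_nat (Suc n) * overshoot (t / Suc n) e \<le> ennreal (?u n)" for n
  proof -
    have "of_nat (Suc n) * overshoot (t / Suc n) e \<le> ennreal (real (Suc n))
        * ennreal (exp (- sqrt (Suc n) * e + \<sigma>\<^sup>2 * sqrt (Suc n) * (\<gamma> + sqrt (Suc n)) * (t / Suc n) / 2))"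
      using t unfolding ennreal_of_nat_eq_real_of_nat [symmetric]
      by (intro mult_left_mono overshoot_le) auto
    also have "\<dots> = ennreal (?u n)"
      by (rule ennreal_mult' [symmetric]) simp
    finally show ?thesis .
  qed
  then show ?thesis
    by (intro tendsto_sandwich [OF _ _ tendsto_const lim]) auto
qed

section \<open>Exponential moments from the tail bound\<close>

text \<open>Layer-cake formula combined with the tail bound \<open>exp (- \<gamma> * a)\<close>; the
  result is the moment of \<open>expo\<close> itself.\<close>

lemma nn_integral_exp_nu_le:
  assumes \<delta>: "0 < \<delta>" and l: "0 < l" "l < \<gamma>"
  shows "(\<integral>\<^sup>+v. ennreal (exp (l * max v 0)) \<partial>nu \<delta> n) \<le> ennreal (\<gamma> / (\<gamma> - l))"
proof -
  interpret N: prob_space "nu \<delta> n" by (rule prob_space_nu [OF \<delta>])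
  interpret NL: pair_sigma_finite "nu \<delta> n" lborel ..
  let ?g = "\<lambda>v a. ennreal (l * exp (l * a)) * indicator {0..} a * indicator {a<..} v"
  have g_meas [measurable]: "case_prod ?g \<in> borel_measurable (nu \<delta> n \<Otimes>\<^sub>M lborel)"
    unfolding greaterThan_def by measurable
  have layer: "ennreal (exp (l * max v 0)) = 1 + (\<integral>\<^sup>+a. ?g v a \<partial>lborel)" for v
  proof (cases "0 \<le> v")
    case True
    \<comment> \<open>The two integrands differ only at \<open>a = v\<close>, a null set.\<close>
    have "(\<integral>\<^sup>+a. ?g v a \<partial>lborel) = (\<integral>\<^sup>+a. ennreal (l * exp (l * a)) * indicator {0..v} a \<partial>lborel)"
      using AE_lborel_singleton [of v]
      by (intro nn_integral_cong_AE) (auto elim!: eventually_mono simp: indicator_def)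
    also have "\<dots> = ennreal (exp (l * v) - exp (l * 0))"
      using l True by (intro nn_integral_FTC_Icc) (auto intro!: derivative_eq_intros)
    finally show ?thesis
      using True l by (simp add: max_def ennreal_plus [symmetric] flip: ennreal_1 del: ennreal_plus)
  next
    case False
    then have "(\<integral>\<^sup>+a. ?g v a \<partial>lborel) = (\<integral>\<^sup>+a. 0 \<partial>(lborel :: real measure))"
      by (intro nn_integral_cong) (auto simp: indicator_def)
    then show ?thesis using False by (simp add: max_def)
  qed
  have "(\<integral>\<^sup>+v. ennreal (exp (l * max v 0)) \<partial>nu \<delta> n) = 1 + (\<integral>\<^sup>+v. \<integral>\<^sup>+a. ?g v a \<partial>lborel \<partial>nu \<delta> n)"
    using N.emeasure_space_1 by (simp add: layer nn_integral_add)
  also have "(\<integral>\<^sup>+v. \<integral>\<^sup>+a. ?g v a \<partial>lborel \<partial>nu \<delta> n) = (\<integral>\<^sup>+a. \<integral>\<^sup>+v. ?g v a \<partial>nu \<delta> n \<partial>lborel)"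
    by (rule NL.Fubini' [symmetric, OF g_meas])
  also have "\<dots> = (\<integral>\<^sup>+a. ennreal (l * exp (l * a)) * indicator {0..} a * emeasure (nu \<delta> n) {a<..} \<partial>lborel)"
    by (intro nn_integral_cong) (simp add: nn_integral_cmult)
  also have "\<dots> \<le> (\<integral>\<^sup>+a. ennreal (l * exp (- (\<gamma> - l) * a)) * indicator {0..} a \<partial>lborel)"
  proof (intro nn_integral_mono)
    fix a :: real
    have "ennreal (l * exp (l * a)) * emeasure (nu \<delta> n) {a<..} \<le> ennreal (l * exp (l * a)) * ennreal (exp (- \<gamma> * a))"
      by (intro mult_left_mono order_trans [OF nu_tail_le [OF \<delta>]] ennreal_leI) auto
    also have "\<dots> = ennreal (l * exp (- (\<gamma> - l) * a))"
      using l by (simp add: ennreal_mult' [symmetric] exp_add [symmetric] algebra_simps)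
    finally show "ennreal (l * exp (l * a)) * indicator {0..} a * emeasure (nu \<delta> n) {a<..}
        \<le> ennreal (l * exp (- (\<gamma> - l) * a)) * indicator {0..} a"
      by (auto simp: indicator_def)
  qed
  also have "\<dots> = ennreal (0 - (- (l / (\<gamma> - l)) * exp (- (\<gamma> - l) * 0)))"
  proof (intro nn_integral_FTC_atLeast)
    show "((\<lambda>a. - (l / (\<gamma> - l)) * exp (- (\<gamma> - l) * a)) \<longlongrightarrow> 0) at_top"
      using l by real_asymp
    have "((\<lambda>a. - (l / d) * exp (- d * a)) has_real_derivative l * exp (- d * a)) (at a)" if "d \<noteq> 0" for d a :: real
      using that by (auto intro!: derivative_eq_intros)
    from this [of "\<gamma> - l"] show "((\<lambda>a. - (l / (\<gamma> - l)) * exp (- (\<gamma> - l) * a)) has_real_derivative l * exp (- (\<gamma> - l) * a)) (at a)" for a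
      using l by simp
  qed (use l in auto)
  also have "1 + \<dots> = ennreal (\<gamma> / (\<gamma> - l))"
    using l by (simp add: ennreal_plus [symmetric] field_simps flip: ennreal_1 del: ennreal_plus)
  finally show ?thesis
    by (simp add: add_left_mono)
qed

section \<open>Convergence to the exponential law as the grid is refined\<close>

text \<open>The upper bound holds for every \<open>n\<close>. For the lower one, continuity provides
  a shift \<open>e\<close> with the shifted tail still above \<open>y\<close>; then the accumulated
  overshoot vanishes as \<open>n\<close> grows.\<close>

lemma nu_tail_tendsto:
  assumes t: "0 < t"
  shows "(\<lambda>n. emeasure (nu (t / Suc n) (Suc n)) {a<..}) \<longlonglongrightarrow> ennreal (min 1 (exp (- \<gamma> * a)))"
proof (rule order_tendstoI)
  fix y assume "ennreal (min 1 (exp (- \<gamma> * a))) < y"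
  then show "\<forall>\<^sub>F n in sequentially. emeasure (nu (t / Suc n) (Suc n)) {a<..} < y"
    using t by (intro always_eventually allI le_less_trans [OF nu_tail_le]) auto
next
  fix y assume y: "y < ennreal (min 1 (exp (- \<gamma> * a)))"
  have "((\<lambda>e. ennreal (min 1 (exp (- \<gamma> * (a + e))))) \<longlongrightarrow> ennreal (min 1 (exp (- \<gamma> * (a + 0))))) (at_right 0)"
    by (intro tendsto_intros)
  then have "\<forall>\<^sub>F e in at_right 0. y < ennreal (min 1 (exp (- \<gamma> * (a + e))))"
    by (rule order_tendstoD(1)) (use y in simp)
  from eventually_happens' [OF trivial_limit_at_right_real eventually_conj [OF this eventually_at_right_less]]
  obtain e where e: "0 < e" "y < ennreal (min 1 (exp (- \<gamma> * (a + e))))"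
    by blast
  define m where "m = ennreal (min 1 (exp (- \<gamma> * (a + e))))"
  have "(\<lambda>n. m - of_nat (Suc n) * overshoot (t / Suc n) e) \<longlonglongrightarrow> m - 0"
    by (intro tendsto_diff_ennreal tendsto_const overshoot_tendsto_0 t e) (simp_all add: m_def)
  then have "\<forall>\<^sub>F n in sequentially. y < m - of_nat (Suc n) * overshoot (t / Suc n) e"
    by (rule order_tendstoD(1)) (use e in \<open>simp add: m_def\<close>)
  then show "\<forall>\<^sub>F n in sequentially. y < emeasure (nu (t / Suc n) (Suc n)) {a<..}"
  proof (rule eventually_mono)
    fix n assume *: "y < m - of_nat (Suc n) * overshoot (t / Suc n) e"
    have "m \<le> of_nat (Suc n) * overshoot (t / Suc n) e + emeasure (nu (t / Suc n) (Suc n)) {a<..}"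
      using nu_tail_ge [of "t / Suc n" e a "Suc n"] t e by (simp add: m_def add.commute)
    then have "m - of_nat (Suc n) * overshoot (t / Suc n) e \<le> emeasure (nu (t / Suc n) (Suc n)) {a<..}"
      by (subst ennreal_minus_le_iff) (auto simp: m_def)
    with * show "y < emeasure (nu (t / Suc n) (Suc n)) {a<..}" by (rule less_le_trans)
  qed
qed

lemma real_distribution_nu: "0 < \<delta> \<Longrightarrow> real_distribution (nu \<delta> n)"
  by (simp add: real_distribution_def real_distribution_axioms_def prob_space_nu)

lemma cdf_nu:
  assumes "0 < \<delta>"
  shows "cdf (nu \<delta> n) a = 1 - measure (nu \<delta> n) {a<..}"
proof -
  interpret prob_space "nu \<delta> n" by (rule prob_space_nu [OF assms])
  have "{..a} = space (nu \<delta> n) - {a<..}" by auto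
  then have "prob {..a} = 1 - prob {a<..}"
    using prob_compl [of "{a<..}"] by simp
  then show ?thesis by (simp add: cdf_def)
qed

lemma weak_conv_nu:
  assumes t: "0 < t"
  shows "weak_conv_m (\<lambda>n. nu (t / Suc n) (Suc n)) expo"
  unfolding weak_conv_m_def weak_conv_def
proof (intro allI impI)
  fix a
  have "(\<lambda>n. enn2real (emeasure (nu (t / Suc n) (Suc n)) {a<..})) \<longlonglongrightarrow> min 1 (exp (- \<gamma> * a))"
    by (rule tendsto_enn2real [OF nu_tail_tendsto [OF t]]) simp
  also have "min 1 (exp (- \<gamma> * a)) = measure expo {a<..}"
    by (simp add: measure_def emeasure_expo_tail)
  finally have "(\<lambda>n. measure (nu (t / Suc n) (Suc n)) {a<..}) \<longlonglongrightarrow> measure expo {a<..}"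
    by (simp add: measure_def)
  \<comment> \<open>The limit law is written \<open>nu t 0\<close>, so that \<open>cdf_nu\<close>
    covers it as well.\<close>
  then have "(\<lambda>n. 1 - measure (nu (t / Suc n) (Suc n)) {a<..}) \<longlonglongrightarrow> 1 - measure (nu t 0) {a<..}"
    by (intro tendsto_intros) simp
  then show "(\<lambda>n. cdf (nu (t / Suc n) (Suc n)) a) \<longlonglongrightarrow> cdf expo a"
    using t cdf_nu [of t 0] by (simp add: cdf_nu)
qed

text \<open>Weak convergence handles the truncations \<open>min (f v) (Suc k)\<close>. Because
  \<open>2 * \<beta> < \<gamma>\<close>, second moments are bounded uniformly in \<open>n\<close>,
  and so is the truncation error, by \<open>D / Suc k\<close>.\<close>

lemma nn_integral_nu_tendsto:
  fixes f :: "real \<Rightarrow> real"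
  assumes t: "0 < t" and f_cont: "continuous_on UNIV f" and \<beta>: "0 < \<beta>" "2 * \<beta> < \<gamma>"
    and f: "\<And>v. 0 \<le> f v" "\<And>v. f v \<le> A * exp (\<beta> * max v 0)"
  shows "(\<lambda>n. \<integral>\<^sup>+v. ennreal (f v) \<partial>nu (t / Suc n) (Suc n)) \<longlonglongrightarrow> (\<integral>\<^sup>+v. ennreal (f v) \<partial>expo)"
proof -
  have [measurable]: "f \<in> borel_measurable borel"
    by (rule borel_measurable_continuous_onI [OF f_cont])
  have A: "0 \<le> A"
    using f [of 0] by simp
  \<comment> \<open>Uniform bound on the second moment, from
    \<open>(f v)\<^sup>2 \<le> A\<^sup>2 * exp (2 * \<beta> * max v 0)\<close>.\<close>
  define D where "D = A\<^sup>2 * (\<gamma> / (\<gamma> - 2 * \<beta>))"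
  have approx: "integrable (nu \<delta> n) f"
      "\<bar>(\<integral>v. f v \<partial>nu \<delta> n) - (\<integral>v. min (f v) (Suc k) \<partial>nu \<delta> n)\<bar> \<le> D / Suc k"
    if \<delta>: "0 < \<delta>" for \<delta> n and k :: nat
  proof -
    interpret N: prob_space "nu \<delta> n" by (rule prob_space_nu [OF \<delta>])
    let ?g = "\<lambda>v. A\<^sup>2 * exp (2 * \<beta> * max v 0)"
    have "(\<integral>\<^sup>+v. ennreal (?g v) \<partial>nu \<delta> n) = ennreal (A\<^sup>2) * (\<integral>\<^sup>+v. ennreal (exp (2 * \<beta> * max v 0)) \<partial>nu \<delta> n)"
      by (simp add: ennreal_mult' nn_integral_cmult)
    also have "\<dots> \<le> ennreal (A\<^sup>2) * ennreal (\<gamma> / (\<gamma> - 2 * \<beta>))"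
      using \<delta> \<beta> by (intro mult_left_mono nn_integral_exp_nu_le) auto
    also have "\<dots> = ennreal D"
      unfolding D_def by (rule ennreal_mult' [symmetric]) simp
    finally have g_le: "(\<integral>\<^sup>+v. ennreal (?g v) \<partial>nu \<delta> n) \<le> ennreal D" .
    then have int_g: "integrable (nu \<delta> n) ?g"
      by (intro integrableI_nonneg) (auto intro: le_less_trans)
    have D: "0 \<le> D"
      using \<beta> gamma_pos by (simp add: D_def)
    have int_g_le: "(\<integral>v. ?g v \<partial>nu \<delta> n) \<le> D"
      using g_le D by (subst integral_eq_nn_integral) (auto intro!: enn2real_leI)
    have sq: "(f v)\<^sup>2 \<le> ?g v" for v
    proof -
      have "(f v)\<^sup>2 \<le> (A * exp (\<beta> * max v 0))\<^sup>2"
        using f [of v] by (intro power_mono)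
      also have "\<dots> = ?g v"
        by (simp add: power_mult_distrib exp_double [symmetric] mult.assoc)
      finally show ?thesis .
    qed
    show int_f: "integrable (nu \<delta> n) f"
    proof (rule Bochner_Integration.integrable_bound)
      show "integrable (nu \<delta> n) (\<lambda>v. 1 + ?g v)"
        using int_g by simp
      show "AE v in nu \<delta> n. norm (f v) \<le> norm (1 + ?g v)"
      proof (intro AE_I2)
        fix v
        have "f v \<le> 1 + (f v)\<^sup>2"
          using zero_le_power2 [of "f v - 1"] f(1) [of v] by (simp add: power2_diff)
        with sq [of v] have "f v \<le> 1 + ?g v" by linarith
        with f(1) [of v] show "norm (f v) \<le> norm (1 + ?g v)" unfolding real_norm_def by linarith
      qed
    qed simp
    have int_min: "integrable (nu \<delta> n) (\<lambda>v. min (f v) (Suc k))"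
      using int_f by (rule Bochner_Integration.integrable_bound) (auto simp: f(1) min_def)
    have "(\<integral>v. f v \<partial>nu \<delta> n) - (\<integral>v. min (f v) (Suc k) \<partial>nu \<delta> n) = (\<integral>v. f v - min (f v) (Suc k) \<partial>nu \<delta> n)"
      using int_f int_min by simp
    moreover have "0 \<le> (\<integral>v. f v - min (f v) (Suc k) \<partial>nu \<delta> n)"
      by (intro integral_nonneg_AE) auto
    moreover have "(\<integral>v. f v - min (f v) (Suc k) \<partial>nu \<delta> n) \<le> (\<integral>v. ?g v / Suc k \<partial>nu \<delta> n)"
    proof (intro integral_mono)
      fix v
      \<comment> \<open>Where \<open>f v\<close> exceeds \<open>Suc k\<close>, the factor
        \<open>f v / Suc k\<close> is at least 1.\<close>
      have "f v - min (f v) (Suc k) \<le> (f v)\<^sup>2 / Suc k"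
      proof (cases "f v \<le> Suc k")
        case False
        then have "f v * Suc k \<le> (f v)\<^sup>2"
          unfolding power2_eq_square using f(1) [of v] by (intro mult_left_mono) auto
        then have "f v \<le> (f v)\<^sup>2 / Suc k"
          by (subst pos_le_divide_eq) auto
        then show ?thesis
          using False by linarith
      qed simp
      also have "\<dots> \<le> ?g v / Suc k"
        using sq [of v] by (intro divide_right_mono) auto
      finally show "f v - min (f v) (Suc k) \<le> ?g v / Suc k" .
    qed (use int_f int_min int_g in auto)
    moreover have "(\<integral>v. ?g v / Suc k \<partial>nu \<delta> n) \<le> D / Suc k"
      using int_g_le by (simp add: divide_right_mono)
    ultimately show "\<bar>(\<integral>v. f v \<partial>nu \<delta> n) - (\<integral>v. min (f v) (Suc k) \<partial>nu \<delta> n)\<bar> \<le> D / Suc k"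
      by linarith
  qed
  have int_conv: "(\<lambda>n. \<integral>v. f v \<partial>nu (t / Suc n) (Suc n)) \<longlonglongrightarrow> (\<integral>v. f v \<partial>nu t 0)"
  proof (rule tendsto_uniform_approx [where D = D
        and J = "\<lambda>n k. \<integral>v. min (f v) (Suc k) \<partial>nu (t / Suc n) (Suc n)" and J' = "\<lambda>k. \<integral>v. min (f v) (Suc k) \<partial>nu t 0"])
    fix k
    have "norm (min (f v) (Suc k)) \<le> Suc k" for v
      using f(1) [of v] by auto
    moreover have "isCont (\<lambda>v. min (f v) (Suc k)) v" for v
      using f_cont by (intro continuous_intros) (simp add: continuous_on_eq_continuous_at)
    ultimately show "(\<lambda>n. \<integral>v. min (f v) (Suc k) \<partial>nu (t / Suc n) (Suc n)) \<longlonglongrightarrow> (\<integral>v. min (f v) (Suc k) \<partial>nu t 0)"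
      using t weak_conv_nu [OF t] real_distribution_nu [of t 0]
      by (intro weak_conv_imp_integral_bdd_continuous_conv [where B = "real (Suc k)"] real_distribution_nu) simp_all
  next
    show "\<bar>(\<integral>v. f v \<partial>nu (t / Suc n) (Suc n)) - (\<integral>v. min (f v) (Suc k) \<partial>nu (t / Suc n) (Suc n))\<bar> \<le> D / Suc k" for n k
      using t by (intro approx(2)) simp
    show "\<bar>(\<integral>v. f v \<partial>nu t 0) - (\<integral>v. min (f v) (Suc k) \<partial>nu t 0)\<bar> \<le> D / Suc k" for k
      using t by (intro approx(2)) simp
  qed
  have "(\<integral>\<^sup>+v. ennreal (f v) \<partial>nu \<delta> n) = ennreal (\<integral>v. f v \<partial>nu \<delta> n)" if "0 < \<delta>" for \<delta> n
    using approx(1) [OF that] f(1) by (intro nn_integral_eq_integral) auto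
  note eq = this
  have "(\<lambda>n. ennreal (\<integral>v. f v \<partial>nu (t / Suc n) (Suc n))) \<longlonglongrightarrow> ennreal (\<integral>v. f v \<partial>nu t 0)"
    by (rule tendsto_ennrealI [OF int_conv])
  then show ?thesis
    using t eq [OF t, of 0] by (simp only: eq [symmetric] divide_pos_pos of_nat_0_less_iff zero_less_Suc nu_0)
qed

section \<open>Distance of the walk from its stationary regime\<close>

lemma AE_expo_nonneg: "AE v in expo. 0 \<le> v"
  by (simp add: AE_density exponential_density_def)

text \<open>For \<open>l \<le> \<gamma> / 2\<close> the moment
  \<open>\<gamma> / (\<gamma> - l)\<close> is at most 2; this is the summand 2 of the final
  bounds.\<close>

lemma nn_integral_exp_nu_le_2:
  assumes \<delta>: "0 < \<delta>" and l: "0 < l" "2 * l \<le> \<gamma>"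
  shows "(\<integral>\<^sup>+v. ennreal (exp (l * max v 0)) \<partial>nu \<delta> n) \<le> 2"
proof -
  have "(\<integral>\<^sup>+v. ennreal (exp (l * max v 0)) \<partial>nu \<delta> n) \<le> ennreal (\<gamma> / (\<gamma> - l))"
    using l gamma_pos by (intro nn_integral_exp_nu_le \<delta>) auto
  also have "\<gamma> / (\<gamma> - l) \<le> 2"
    using l gamma_pos by (simp add: divide_le_eq)
  finally show ?thesis
    by (simp add: ennreal_leI)
qed

text \<open>Averaging the second starting point over \<open>expo\<close> turns the oscillation bound
  into a comparison with \<open>nu\<close>. Both directions are stated since the mean cost may
  approach its stationary value from either side.\<close>

lemma funpow_reflect_op_near_nu:
  assumes \<delta>: "0 < \<delta>" and l: "0 < l" "2 * l \<le> \<gamma>" and A: "0 \<le> A" and f: "f \<in> borel_measurable borel"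
    and osc: "\<And>v v'. 0 \<le> v \<Longrightarrow> 0 \<le> v' \<Longrightarrow> f v \<le> f v' + ennreal (A * exp (l * max v v'))"
    and v: "0 \<le> v"
  shows "(P \<delta> ^^ n) f v \<le> (\<integral>\<^sup>+v. f v \<partial>nu \<delta> n) + ennreal (A * exp (- rate l * (n * \<delta>))) * (ennreal (exp (l * v)) + 2)"
    and "(\<integral>\<^sup>+v. f v \<partial>nu \<delta> n) \<le> (P \<delta> ^^ n) f v + ennreal (A * exp (- rate l * (n * \<delta>))) * (ennreal (exp (l * v)) + 2)"
proof -
  interpret E: prob_space expo
    using gamma_pos by (rule prob_space_exponential_density)
  let ?c = "ennreal (A * exp (- rate l * (n * \<delta>)))"
  let ?e = "\<lambda>v. ennreal (exp (l * max v 0))"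
  note [measurable] = measurable_funpow_reflect_op [OF \<delta> f, of n]
  have c_max: "ennreal (A * exp (- rate l * (n * \<delta>)) * exp (l * max u u')) \<le> ?c * (ennreal (exp (l * u)) + ?e u')" for u u'
  proof -
    \<comment> \<open>Bounding the maximum by a sum separates the two starting points, so that only
      one of them has to be integrated.\<close>
    have "exp (l * max u u') \<le> exp (l * u) + exp (l * max u' 0)"
    proof (cases "u \<le> u'")
      case True
      then have "exp (l * max u u') \<le> exp (l * max u' 0)"
        using l by simp
      then show ?thesis using exp_gt_zero [of "l * u"] by linarith
    qed (simp add: max_def)
    then have "ennreal (A * exp (- rate l * (n * \<delta>)) * exp (l * max u u')) \<le> ?c * ennreal (exp (l * u) + exp (l * max u' 0))"
      using A by (subst ennreal_mult' [symmetric]) (auto intro!: ennreal_leI mult_left_mono)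
    then show ?thesis by simp
  qed
  have e_int: "(\<integral>\<^sup>+v. ?e v \<partial>expo) \<le> 2"
    using nn_integral_exp_nu_le_2 [OF \<delta> l, of 0] by simp
  have c_int: "(\<integral>\<^sup>+v'. ?c * (ennreal (exp (l * v)) + ?e v') \<partial>expo) \<le> ?c * (ennreal (exp (l * v)) + 2)"
    using E.emeasure_space_1
    by (simp add: nn_integral_cmult nn_integral_add mult_left_mono add_left_mono e_int)
  have "(P \<delta> ^^ n) f v = (\<integral>\<^sup>+v'. (P \<delta> ^^ n) f v \<partial>expo)"
    using E.emeasure_space_1 by simp
  also have "\<dots> \<le> (\<integral>\<^sup>+v'. (P \<delta> ^^ n) f v' + ?c * (ennreal (exp (l * v)) + ?e v') \<partial>expo)"
  \<comment> \<open>The oscillation bound concerns nonnegative starting points; under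
    \<open>expo\<close> these have full measure.\<close>
  proof (intro nn_integral_mono_AE, use AE_expo_nonneg in \<open>elim eventually_mono\<close>)
    fix v' :: real assume "0 \<le> v'"
    then have "(P \<delta> ^^ n) f v \<le> (P \<delta> ^^ n) f v' + ennreal (A * exp (- rate l * (n * \<delta>)) * exp (l * max v v'))"
      using funpow_reflect_op_osc [OF \<delta> l(1) A f osc v] by blast
    also have "\<dots> \<le> (P \<delta> ^^ n) f v' + ?c * (ennreal (exp (l * v)) + ?e v')"
      by (intro add_left_mono c_max)
    finally show "(P \<delta> ^^ n) f v \<le> (P \<delta> ^^ n) f v' + ?c * (ennreal (exp (l * v)) + ?e v')" .
  qed
  also have "\<dots> \<le> (\<integral>\<^sup>+v. f v \<partial>nu \<delta> n) + ?c * (ennreal (exp (l * v)) + 2)"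
    using c_int by (simp add: nn_integral_add nn_integral_nu [OF \<delta> f] add_left_mono)
  finally show "(P \<delta> ^^ n) f v \<le> (\<integral>\<^sup>+v. f v \<partial>nu \<delta> n) + ?c * (ennreal (exp (l * v)) + 2)" .
  have "(\<integral>\<^sup>+v. f v \<partial>nu \<delta> n) = (\<integral>\<^sup>+v'. (P \<delta> ^^ n) f v' \<partial>expo)"
    by (rule nn_integral_nu [OF \<delta> f])
  also have "\<dots> \<le> (\<integral>\<^sup>+v'. (P \<delta> ^^ n) f v + ?c * (ennreal (exp (l * v)) + ?e v') \<partial>expo)"
  proof (intro nn_integral_mono_AE, use AE_expo_nonneg in \<open>elim eventually_mono\<close>)
    fix v' :: real assume "0 \<le> v'"
    then have "(P \<delta> ^^ n) f v' \<le> (P \<delta> ^^ n) f v + ennreal (A * exp (- rate l * (n * \<delta>)) * exp (l * max v' v))"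
      using funpow_reflect_op_osc [OF \<delta> l(1) A f osc _ v] by blast
    also have "\<dots> \<le> (P \<delta> ^^ n) f v + ?c * (ennreal (exp (l * v)) + ?e v')"
      unfolding max.commute [of v' v] by (intro add_left_mono c_max)
    finally show "(P \<delta> ^^ n) f v' \<le> (P \<delta> ^^ n) f v + ?c * (ennreal (exp (l * v)) + ?e v')" .
  qed
  also have "\<dots> \<le> (P \<delta> ^^ n) f v + ?c * (ennreal (exp (l * v)) + 2)"
    using c_int E.emeasure_space_1 by (simp add: nn_integral_add add_left_mono)
  finally show "(\<integral>\<^sup>+v. f v \<partial>nu \<delta> n) \<le> (P \<delta> ^^ n) f v + ?c * (ennreal (exp (l * v)) + 2)" .
qed

text \<open>The exponential satisfies the oscillation hypothesis with \<open>A = 1\<close>. Of the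
  4, one 2 is its moment under \<open>nu\<close>, the other comes from averaging the starting point;
  the decay factor is bounded by 1, so the bound is uniform in \<open>n\<close>.\<close>

lemma funpow_reflect_op_exp_le:
  assumes \<delta>: "0 < \<delta>" and l: "0 < l" "2 * l \<le> \<gamma>" and v: "0 \<le> v"
  shows "(P \<delta> ^^ n) (\<lambda>v. ennreal (exp (l * max v 0))) v \<le> ennreal (exp (l * v)) + 4"
proof -
  let ?e = "\<lambda>v. ennreal (exp (l * max v 0))"
  have osc: "?e u \<le> ?e u' + ennreal (1 * exp (l * max u u'))" if "0 \<le> u" "0 \<le> u'" for u u'
    using that l by (intro add_increasing ennreal_leI) auto
  have "(P \<delta> ^^ n) ?e v \<le> (\<integral>\<^sup>+v. ?e v \<partial>nu \<delta> n) + ennreal (1 * exp (- rate l * (n * \<delta>))) * (ennreal (exp (l * v)) + 2)"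
    by (rule funpow_reflect_op_near_nu(1) [OF \<delta> l _ _ osc v]) auto
  also have "\<dots> \<le> 2 + 1 * (ennreal (exp (l * v)) + 2)"
  proof (intro add_mono mult_right_mono nn_integral_exp_nu_le_2 \<delta> l)
    have "0 \<le> rate l"
      using l gamma_pos by (simp add: rate_def)
    then have "exp (- rate l * (n * \<delta>)) \<le> 1"
      using \<delta> by simp
    then show "ennreal (1 * exp (- rate l * (n * \<delta>))) \<le> 1"
      by (simp flip: ennreal_1 add: ennreal_leI del: ennreal_1)
  qed auto
  also have "\<dots> = ennreal (exp (l * v)) + 4"
    by (simp add: ac_simps flip: numeral_plus_numeral)
  finally show ?thesis .
qed

end

subsection \<open>Reflected paths\<close>

text \<open>Take the last visit to the barrier. The measure of \<open>y\<close> does not charge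
  times at which \<open>z\<close> is above \<open>r\<close>, so \<open>y\<close> is constant
  afterwards; without a visit it has not moved from 0.\<close>

lemma reflection_attained:
  fixes z y :: "real \<Rightarrow> real"
  assumes st: "s \<le> t" and z: "continuous_on {s..} z" and y: "continuous_on {s..} y"
    and mono: "mono_on {s..} y" and y0: "y s = 0" and zr: "\<And>u. s \<le> u \<Longrightarrow> r \<le> z u"
    and compl: "(LINT u:{s..t}|interval_measure (\<lambda>v. y (max s v)). indicat_real {v. z v > r} u) = 0"
  shows "y t = 0 \<or> (\<exists>u\<in>{s..t}. z u = r \<and> y u = y t)"
proof -
  let ?\<mu> = "interval_measure (\<lambda>v. y (max s v))"
  let ?A = "{u\<in>{s..t}. z u > r}"
  have y_mono: "\<And>u v. u \<le> v \<Longrightarrow> y (max s u) \<le> y (max s v)"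
    using mono by (auto intro!: mono_onD [OF mono])
  have y_cont: "continuous_on UNIV (\<lambda>v. y (max s v))"
    by (intro continuous_on_compose2 [OF y] continuous_intros) auto
  have y_right: "\<And>a. continuous (at_right a) (\<lambda>v. y (max s v))"
    using y_cont by (meson UNIV_I continuous_on_eq_continuous_within continuous_within_subset subset_UNIV)
  have cl: "closed {u\<in>{s..t}. z u \<le> r}"
    using z by (intro continuous_on_closed_Collect_le) (auto intro: continuous_on_subset)
  have "?A = {s..t} - {u\<in>{s..t}. z u \<le> r}"
    by auto
  moreover have "{s..t} - {u\<in>{s..t}. z u \<le> r} \<in> sets borel"
    by (intro sets.Diff borel_closed cl closed_atLeastAtMost)
  ultimately have A: "?A \<in> sets borel"
    by simp
  \<comment> \<open>The Bochner integral of an indicator is 0 also on sets of infinite measure;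
    finiteness is what turns \<open>compl\<close> into a null set.\<close>
  have fin: "emeasure ?\<mu> {s..t} = ennreal (y t - y s)"
    using emeasure_interval_measure_Icc [OF st y_mono y_cont] st by simp
  have "emeasure ?\<mu> ?A \<le> emeasure ?\<mu> {s..t}"
    by (intro emeasure_mono) auto
  also have "emeasure ?\<mu> {s..t} < \<infinity>"
    by (simp add: fin)
  finally have "emeasure ?\<mu> ?A < \<infinity>" .
  moreover have "measure ?\<mu> ?A = 0"
  proof -
    have "(LINT u:{s..t}|?\<mu>. indicat_real {v. z v > r} u) = (\<integral>u. indicat_real ?A u \<partial>?\<mu>)"
      unfolding set_lebesgue_integral_def by (intro Bochner_Integration.integral_cong) (auto simp: indicator_def)
    then show ?thesis using compl by simp
  qed
  ultimately have null: "emeasure ?\<mu> ?A = 0"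
    by (auto simp: measure_def enn2real_eq_0_iff)
  have const: "y t = y u" if u: "u \<in> {s..t}" and above: "\<And>v. v \<in> {u<..t} \<Longrightarrow> r < z v" for u
  proof -
    have "emeasure ?\<mu> {u<..t} \<le> emeasure ?\<mu> ?A"
      using A u above by (intro emeasure_mono) auto
    then have "ennreal (y t - y u) = 0"
      using u null emeasure_interval_measure_Ioc [of u t "\<lambda>v. y (max s v)", OF _ y_mono y_right] by simp
    moreover have "y u \<le> y t"
      using u by (intro mono_onD [OF mono]) auto
    ultimately show ?thesis by (simp add: ennreal_eq_0_iff)
  qed
  show ?thesis
  proof (cases "{u\<in>{s..t}. z u \<le> r} = {}")
    case True
    then have "y t = y s"
      using st by (intro const) force+
    then show ?thesis using y0 by simp
  next
    case False
    have bdd: "bdd_above {u\<in>{s..t}. z u \<le> r}"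
      by (rule bdd_above_mono [of "{s..t}"]) auto
    \<comment> \<open>The last visit: the visits form a nonempty, closed, bounded set, which
      contains its supremum.\<close>
    have "Sup {u\<in>{s..t}. z u \<le> r} \<in> {u\<in>{s..t}. z u \<le> r}" (is "?u \<in> _")
      by (rule closed_contains_Sup [OF False bdd cl])
    moreover have "y t = y ?u"
    proof (rule const)
      show "r < z v" if v: "v \<in> {?u<..t}" for v
      proof (rule ccontr)
        assume "\<not> r < z v"
        with v \<open>?u \<in> _\<close> have "v \<le> ?u"
          by (intro cSup_upper bdd) auto
        with v show False by simp
      qed
    qed (use \<open>?u \<in> _\<close> in auto)
    ultimately show ?thesis
      using zr [of ?u] by (intro disjI2 bexI [of _ ?u]) auto
  qed
qed

subsection \<open>Skeletons of reflected Brownian motion\<close>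

locale driven_BM = drifted_BM +
  fixes M :: "'a measure" and F :: "real \<Rightarrow> 'a measure" and B :: "real \<Rightarrow> 'a \<Rightarrow> real"
  assumes BM: "standard_BM M F B"
begin

definition incr :: "real \<Rightarrow> real \<Rightarrow> 'a \<Rightarrow> real" where
  "incr u t \<omega> = \<theta> * (t - u) + \<sigma> * (B t \<omega> - B u \<omega>)"

lemma incr_self [simp]: "incr u u \<omega> = 0"
  by (simp add: incr_def)

lemma incr_add: "incr u v \<omega> + incr v t \<omega> = incr u t \<omega>"
  by (simp add: incr_def algebra_simps)

lemma prob_space_M: "prob_space M"
  using BM by (simp add: standard_BM_def filtered_prob_space_def)

lemma subalg: "0 \<le> t \<Longrightarrow> subalgebra M (F t)"
  using BM by (simp add: standard_BM_def filtered_prob_space_def)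

lemma space_F: "0 \<le> t \<Longrightarrow> space (F t) = space M"
  using subalg by (simp add: subalgebra_def)

lemma measurable_F_mono:
  assumes "0 \<le> s" "s \<le> t" and "f \<in> measurable (F s) N"
  shows "f \<in> measurable (F t) N"
  using BM assms by (auto simp: standard_BM_def filtered_prob_space_def intro: measurable_from_subalg)

lemma measurable_F_M:
  assumes "0 \<le> s" and "f \<in> measurable (F s) N"
  shows "f \<in> measurable M N"
  using assms by (auto intro: measurable_from_subalg subalg)

lemma incr_measurable:
  assumes "0 \<le> u" "u \<le> t"
  shows "incr u t \<in> borel_measurable (F t)"
proof -
  have "B u \<in> borel_measurable (F t)" "B t \<in> borel_measurable (F t)"
    using BM assms by (auto simp: standard_BM_def intro: measurable_F_mono)
  then show ?thesis
    unfolding incr_def by measurable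
qed

lemma incr_continuous:
  assumes "\<omega> \<in> space M"
  shows "continuous_on {0..} (\<lambda>u. incr u t \<omega>)"
  using BM assms unfolding incr_def standard_BM_def by (auto intro!: continuous_intros)

lemma distr_incr:
  assumes "0 \<le> u" "u < t"
  shows "distr M borel (incr u t) = gauss (t - u)"
proof -
  interpret prob_space M by (rule prob_space_M)
  have "distributed M lborel (\<lambda>\<omega>. B t \<omega> - B u \<omega>) (normal_density 0 (sqrt (t - u)))"
    using BM assms by (simp add: standard_BM_def)
  from normal_density_affine [OF this, of \<sigma> "\<theta> * (t - u)"]
  have "distributed M lborel (incr u t) (normal_density (\<theta> * (t - u)) (\<sigma> * sqrt (t - u)))"
    using assms sigma_pos by (simp add: incr_def [abs_def])
  then have "distr M lborel (incr u t) = gauss (t - u)"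
    by (simp add: distributed_distr_eq_density gauss_def)
  moreover have "distr M lborel (incr u t) = distr M borel (incr u t)"
    by (intro distr_cong) auto
  ultimately show ?thesis by simp
qed

section \<open>Markov property of the driving noise\<close>

text \<open>\<open>indep_var\<close> relates variables of one value type, so the increment carries a
  dummy component 0 to match \<open>X\<close>, which will hold the barrier and the state
  together.\<close>

lemma indep_incr:
  fixes X :: "'a \<Rightarrow> real \<times> real"
  assumes u: "0 \<le> u" "u < t" and X: "X \<in> measurable (F u) S"
  shows "prob_space.indep_var M S X (borel \<Otimes>\<^sub>M borel) (\<lambda>\<omega>. (incr u t \<omega>, 0))"
proof -
  interpret prob_space M by (rule prob_space_M)
  let ?D = "\<lambda>\<omega>. B t \<omega> - B u \<omega>"
  \<comment> \<open>The sigma-algebra generated by the Brownian increment; the drifted pair is a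
    function of that increment and so generates no larger one.\<close>
  let ?E = "vimage_algebra (space M) ?D borel"
  have E: "sets ?E = {?D -` A \<inter> space M | A. A \<in> sets borel}"
    by (rule sets_vimage_algebra2) simp
  have ind: "indep_set (sets (F u)) (sets ?E)"
    using BM u by (simp add: standard_BM_def E)
  have 1: "sigma_sets (space M) {X -` A \<inter> space M | A. A \<in> sets S} \<subseteq> sets (F u)"
    using sets.sigma_sets_subset [of "{X -` A \<inter> space M | A. A \<in> sets S}" "F u"] measurable_sets [OF X]
      space_F [OF u(1)] by auto
  let ?Y = "\<lambda>\<omega>. (incr u t \<omega>, 0 :: real)"
  let ?T = "borel \<Otimes>\<^sub>M borel :: (real \<times> real) measure"
  have "?Y -` A \<inter> space M \<in> sets ?E" if A: "A \<in> sets ?T" for A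
  proof -
    have eq: "?Y -` A \<inter> space M = ?D -` ((\<lambda>x. (\<theta> * (t - u) + \<sigma> * x, 0)) -` A) \<inter> space M"
      by (auto simp: incr_def)
    have m: "(\<lambda>x. (\<theta> * (t - u) + \<sigma> * x, 0 :: real)) \<in> borel \<rightarrow>\<^sub>M ?T"
      by measurable
    have "(\<lambda>x. (\<theta> * (t - u) + \<sigma> * x, 0)) -` A \<in> sets borel"
      using measurable_sets [OF m A] by simp
    then show ?thesis
      unfolding E eq
      by (intro CollectI exI [of _ "(\<lambda>x. (\<theta> * (t - u) + \<sigma> * x, 0)) -` A"] conjI refl)
  qed
  then have 2: "sigma_sets (space M) {?Y -` A \<inter> space M | A. A \<in> sets ?T} \<subseteq> sets ?E"
    using sets.sigma_sets_subset [of "{?Y -` A \<inter> space M | A. A \<in> sets ?T}" ?E] by auto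
  have "indep_set (sigma_sets (space M) {X -` A \<inter> space M | A. A \<in> sets S})
      (sigma_sets (space M) {?Y -` A \<inter> space M | A. A \<in> sets ?T})"
    using ind 1 2 unfolding indep_set_def
    by (elim indep_sets_mono_sets) (simp split: bool.split)
  moreover have "random_variable S X"
    using u by (intro measurable_F_M [OF _ X])
  moreover have "incr u t \<in> borel_measurable M"
    using u by (intro measurable_F_M [OF _ incr_measurable]) auto
  then have "random_variable ?T ?Y"
    by measurable
  ultimately show ?thesis by (simp add: indep_var_eq)
qed

text \<open>Markov property: \<open>(R, V)\<close> is known at time \<open>u\<close>, the step is
  independent of it with law \<open>gauss (t - u)\<close>, and Fubini on the product of the laws
  integrates the step out.\<close>

lemma nn_integral_reflect_step:
  fixes R V :: "'a \<Rightarrow> real" and f :: "real \<Rightarrow> real \<Rightarrow> ennreal"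
  assumes u: "0 \<le> u" "u < t" and R: "R \<in> borel_measurable (F u)" and V: "V \<in> borel_measurable (F u)"
    and f: "(\<lambda>(r, v). f r v) \<in> borel_measurable (borel \<Otimes>\<^sub>M borel)"
  shows "(\<integral>\<^sup>+\<omega>. f (R \<omega>) (max (V \<omega> + incr u t \<omega>) 0) \<partial>M) = (\<integral>\<^sup>+\<omega>. P (t - u) (f (R \<omega>)) (V \<omega>) \<partial>M)"
proof -
  interpret prob_space M by (rule prob_space_M)
  note f [measurable]
  note [measurable] = measurable_F_M [OF u(1) R] measurable_F_M [OF u(1) V]
  have [measurable]: "incr u t \<in> borel_measurable M"
    using u by (auto intro: measurable_F_M [OF _ incr_measurable])
  let ?X = "\<lambda>\<omega>. (R \<omega>, V \<omega>)"
  let ?S = "borel \<Otimes>\<^sub>M borel :: (real \<times> real) measure"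
  have X: "?X \<in> measurable (F u) ?S"
    using R V by measurable
  let ?Y = "\<lambda>\<omega>. (incr u t \<omega>, 0 :: real)"
  have "?Y \<in> M \<rightarrow>\<^sub>M ?S"
    by measurable
  then interpret Y: prob_space "distr M ?S ?Y"
    by (rule prob_space_distr)
  let ?g = "\<lambda>p. f (fst (fst p)) (max (snd (fst p) + fst (snd p)) 0)"
  have P_eq: "P (t - u) (f r) v = (\<integral>\<^sup>+q. f r (max (v + fst q) 0) \<partial>distr M ?S ?Y)" for r v
    by (simp add: reflect_op_def distr_incr [OF u, symmetric] nn_integral_distr)
  have "distr M (?S \<Otimes>\<^sub>M ?S) (\<lambda>\<omega>. (?X \<omega>, ?Y \<omega>)) = distr M ?S ?X \<Otimes>\<^sub>M distr M ?S ?Y"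
    using indep_incr [OF u X] by (simp add: indep_var_distribution_eq)
  then have "(\<integral>\<^sup>+p. ?g p \<partial>distr M (?S \<Otimes>\<^sub>M ?S) (\<lambda>\<omega>. (?X \<omega>, ?Y \<omega>)))
      = (\<integral>\<^sup>+p. ?g p \<partial>(distr M ?S ?X \<Otimes>\<^sub>M distr M ?S ?Y))"
    by simp
  also have "\<dots> = (\<integral>\<^sup>+p. \<integral>\<^sup>+q. ?g (p, q) \<partial>distr M ?S ?Y \<partial>distr M ?S ?X)"
    by (rule Y.nn_integral_fst [symmetric]) measurable
  also have "\<dots> = (\<integral>\<^sup>+\<omega>. \<integral>\<^sup>+q. ?g (?X \<omega>, q) \<partial>distr M ?S ?Y \<partial>M)"
    by (rule nn_integral_distr) measurable
  also have "\<dots> = (\<integral>\<^sup>+\<omega>. P (t - u) (f (R \<omega>)) (V \<omega>) \<partial>M)"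
    by (simp add: P_eq)
  finally show ?thesis
    by (subst (asm) nn_integral_distr) simp_all
qed

section \<open>Reflection on a time grid\<close>

text \<open>Distance above the barrier when reflection acts only at the times
  \<open>s + i * \<delta>\<close>. Measuring from the barrier makes the recursion the same for all
  barriers.\<close>

primrec walk :: "real \<Rightarrow> real \<Rightarrow> ('a \<Rightarrow> real) \<Rightarrow> nat \<Rightarrow> 'a \<Rightarrow> real" where
  "walk s \<delta> V 0 = V"
| "walk s \<delta> V (Suc i) = (\<lambda>\<omega>. max (walk s \<delta> V i \<omega> + incr (s + real i * \<delta>) (s + real (Suc i) * \<delta>) \<omega>) 0)"

lemma walk_nonneg: "0 \<le> V \<omega> \<Longrightarrow> 0 \<le> walk s \<delta> V i \<omega>"
  by (cases i) auto

lemma walk_measurable_F: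
  assumes "0 \<le> s" "0 \<le> \<delta>" and V: "V \<in> borel_measurable (F s)"
  shows "walk s \<delta> V i \<in> borel_measurable (F (s + i * \<delta>))"
proof (induction i)
  case 0
  then show ?case using V by simp
next
  case (Suc i)
  have "incr (s + i * \<delta>) (s + Suc i * \<delta>) \<in> borel_measurable (F (s + Suc i * \<delta>))"
    using assms by (intro incr_measurable) (auto simp: algebra_simps)
  moreover have "walk s \<delta> V i \<in> borel_measurable (F (s + Suc i * \<delta>))"
    using assms by (intro measurable_F_mono [OF _ _ Suc]) (auto simp: algebra_simps)
  ultimately show ?case
    unfolding walk.simps by measurable
qed

lemma walk_measurable:
  assumes "0 \<le> s" "0 \<le> \<delta>" and V: "V \<in> borel_measurable (F s)"
  shows "walk s \<delta> V i \<in> borel_measurable M"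
  using assms by (intro measurable_F_M [OF _ walk_measurable_F]) auto

text \<open>The last step is integrated out and absorbed into \<open>f\<close>, hence the induction
  over all \<open>f\<close>. The barrier \<open>R\<close> is known at time \<open>s\<close> and
  stays a parameter throughout.\<close>

lemma nn_integral_walk:
  fixes R V :: "'a \<Rightarrow> real" and f :: "real \<Rightarrow> real \<Rightarrow> ennreal"
  assumes s: "0 \<le> s" and \<delta>: "0 < \<delta>" and R: "R \<in> borel_measurable (F s)" and V: "V \<in> borel_measurable (F s)"
    and f: "(\<lambda>(r, v). f r v) \<in> borel_measurable (borel \<Otimes>\<^sub>M borel)"
  shows "(\<integral>\<^sup>+\<omega>. f (R \<omega>) (walk s \<delta> V n \<omega>) \<partial>M) = (\<integral>\<^sup>+\<omega>. (P \<delta> ^^ n) (f (R \<omega>)) (V \<omega>) \<partial>M)"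
  using f
proof (induction n arbitrary: f)
  case 0
  then show ?case by simp
next
  case (Suc n)
  have "(\<integral>\<^sup>+\<omega>. f (R \<omega>) (walk s \<delta> V (Suc n) \<omega>) \<partial>M)
      = (\<integral>\<^sup>+\<omega>. P (s + Suc n * \<delta> - (s + n * \<delta>)) (f (R \<omega>)) (walk s \<delta> V n \<omega>) \<partial>M)"
    unfolding walk.simps using s \<delta> walk_measurable_F [OF s _ V, of \<delta> n]
    by (intro nn_integral_reflect_step Suc.prems measurable_F_mono [OF _ _ R]) (auto simp: algebra_simps)
  also have "s + Suc n * \<delta> - (s + n * \<delta>) = \<delta>"
    by (simp add: algebra_simps)
  also have "(\<integral>\<^sup>+\<omega>. P \<delta> (f (R \<omega>)) (walk s \<delta> V n \<omega>) \<partial>M) = (\<integral>\<^sup>+\<omega>. (P \<delta> ^^ n) (P \<delta> (f (R \<omega>))) (V \<omega>) \<partial>M)"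
    by (intro Suc.IH measurable_reflect_op_param \<delta> Suc.prems)
  finally show ?case by (simp add: funpow_swap1)
qed

text \<open>Reflection only pushes up, so the walk stays above the free path from \<open>V\<close>
  and above every free path leaving 0 at a grid time: one half of the Lindley maximum
  formula.\<close>

lemma walk_ge:
  assumes "0 \<le> V \<omega>"
  shows "V \<omega> + incr s (s + i * \<delta>) \<omega> \<le> walk s \<delta> V i \<omega>"
    and "j \<le> i \<Longrightarrow> incr (s + real j * \<delta>) (s + i * \<delta>) \<omega> \<le> walk s \<delta> V i \<omega>"
proof (induction i)
  case 0
  {
    case 1 then show ?case by simp
  next
    case 2 then show ?case using assms by simp
  }
next
  case (Suc i)
  {
    case 1
    show ?case
      using Suc.IH(1) incr_add [of s "s + i * \<delta>" \<omega> "s + Suc i * \<delta>"] by simp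
  next
    case 2
    show ?case
    proof (cases "j = Suc i")
      case True
      then show ?thesis by simp
    next
      case False
      then show ?thesis
        using 2 Suc.IH(2) incr_add [of "s + j * \<delta>" "s + i * \<delta>" \<omega> "s + Suc i * \<delta>"] by simp
    qed
  }
qed

text \<open>The disjunction on \<open>q\<close> says that \<open>q\<close> is at most the value at time \<open>t\<close> of the path started from
  \<open>V\<close> at time \<open>s\<close> and reflected at \<open>0\<close>.\<close>

lemma walk_eventually_ge:
  assumes \<omega>: "\<omega> \<in> space M" and s: "0 \<le> s" "s < t" and V: "0 \<le> V \<omega>"
    and q: "q \<le> V \<omega> + incr s t \<omega> \<or> (\<exists>u\<in>{s..t}. q \<le> incr u t \<omega>)"
    and e: "0 < e"
  shows "\<forall>\<^sub>F n in sequentially. q - e < walk s ((t - s) / Suc n) V (Suc n) \<omega>"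
  using q
proof
  assume q: "q \<le> V \<omega> + incr s t \<omega>"
  have "q - e < walk s ((t - s) / Suc n) V (Suc n) \<omega>" for n
    using walk_ge(1) [where V = V and \<omega> = \<omega>, OF V, of s "Suc n" "(t - s) / Suc n"] q e by (simp del: walk.simps of_nat_Suc)
  then show ?thesis by simp
next
  assume "\<exists>u\<in>{s..t}. q \<le> incr u t \<omega>"
  then obtain u where u: "s \<le> u" "u \<le> t" "q \<le> incr u t \<omega>" by auto
  \<comment> \<open>\<open>v n\<close> is \<open>u\<close> rounded down to the grid of the
    \<open>n\<close>-th walk: a grid time from which \<open>walk_ge\<close> applies, tending to
    \<open>u\<close>.\<close>
  define j where "j n = nat \<lfloor>(u - s) * Suc n / (t - s)\<rfloor>" for n
  define v where "v n = s + j n * ((t - s) / Suc n)" for n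
  have j_le: "j n \<le> Suc n" for n
  proof -
    have "(u - s) * Suc n / (t - s) \<le> Suc n"
      using u s by (simp add: divide_le_eq mult.commute [of "real (Suc n)"] mult_right_mono del: of_nat_Suc)
    then show ?thesis unfolding j_def by linarith
  qed
  have v_close: "\<bar>v n - u\<bar> \<le> (t - s) / Suc n" for n
  proof -
    let ?d = "(t - s) / Suc n"
    have d: "0 < ?d" using s by simp
    have x: "0 \<le> (u - s) * Suc n / (t - s)"
      using u s by simp
    have "\<bar>real (j n) - (u - s) * Suc n / (t - s)\<bar> \<le> 1"
      unfolding j_def using x by linarith
    then have "\<bar>real (j n) - (u - s) * Suc n / (t - s)\<bar> * ?d \<le> 1 * ?d"
      using d by (intro mult_right_mono) auto
    moreover have "(u - s) * Suc n / (t - s) * ?d = u - s"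
      using s by (simp del: of_nat_Suc)
    then have "v n - u = (real (j n) - (u - s) * Suc n / (t - s)) * ?d"
      by (simp only: left_diff_distrib v_def)
    then have "\<bar>v n - u\<bar> = \<bar>real (j n) - (u - s) * Suc n / (t - s)\<bar> * ?d"
      using d by (simp only: abs_mult abs_of_pos)
    ultimately show ?thesis
      by (simp only: mult_1)
  qed
  have "(\<lambda>n. (t - s) / Suc n) \<longlonglongrightarrow> 0"
    by (rule LIMSEQ_Suc [OF lim_const_over_n])
  then have "(\<lambda>n. v n - u) \<longlonglongrightarrow> 0"
    by (rule Lim_null_comparison [rotated]) (simp add: v_close del: of_nat_Suc)
  then have v_lim: "v \<longlonglongrightarrow> u"
    by (rule LIM_zero_cancel)
  have "(\<lambda>n. incr (v n) t \<omega>) \<longlonglongrightarrow> incr u t \<omega>"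
    by (rule continuous_on_tendsto_compose [OF incr_continuous [OF \<omega>] v_lim])
       (use u s in \<open>simp_all add: v_def\<close>)
  then have "\<forall>\<^sub>F n in sequentially. q - e < incr (v n) t \<omega>"
    by (rule order_tendstoD(1)) (use u e in linarith)
  then show ?thesis
  proof (rule eventually_mono)
    fix n assume "q - e < incr (v n) t \<omega>"
    moreover have "incr (v n) t \<omega> \<le> walk s ((t - s) / Suc n) V (Suc n) \<omega>"
      using walk_ge(2) [where V = V and \<omega> = \<omega>, OF V j_le, of s n "(t - s) / Suc n"] s by (simp add: v_def del: walk.simps of_nat_Suc)
    ultimately show "q - e < walk s ((t - s) / Suc n) V (Suc n) \<omega>" by simp
  qed
qed

section \<open>Grid approximation of reflected Brownian motion\<close>

lemma reflected_BM_ge: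
  assumes Z: "reflected_BM F B \<theta> \<sigma> s r y Z Y" and \<omega>: "\<omega> \<in> space M" and t: "s \<le> t"
  shows "r \<omega> \<le> Z t \<omega>" and "Z s \<omega> = y \<omega>"
    and "s \<le> u \<Longrightarrow> u \<le> t \<Longrightarrow> Z t \<omega> = Z u \<omega> + incr u t \<omega> + (Y t \<omega> - Y u \<omega>)"
    and "s \<le> u \<Longrightarrow> u \<le> t \<Longrightarrow> Z u \<omega> + incr u t \<omega> \<le> Z t \<omega>"
proof -
  have \<omega>': "\<omega> \<in> space (F s)"
    using Z \<omega> space_F by (simp add: reflected_BM_def)
  have eq: "Z v \<omega> = y \<omega> + \<theta> * (v - s) + \<sigma> * (B v \<omega> - B s \<omega>) + Y v \<omega>" if "s \<le> v" for v
    using Z \<omega>' that unfolding reflected_BM_def by blast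
  show "r \<omega> \<le> Z t \<omega>"
    using Z \<omega>' t unfolding reflected_BM_def by blast
  have "Y s \<omega> = 0"
    using Z \<omega>' unfolding reflected_BM_def by blast
  then show "Z s \<omega> = y \<omega>"
    using eq [of s] by simp
  show *: "Z t \<omega> = Z u \<omega> + incr u t \<omega> + (Y t \<omega> - Y u \<omega>)" if "s \<le> u" "u \<le> t"
    using eq [of u] eq [of t] that by (simp add: incr_def algebra_simps)
  have "mono_on {s..} (\<lambda>t. Y t \<omega>)"
    using Z \<omega>' unfolding reflected_BM_def by blast
  then show "Z u \<omega> + incr u t \<omega> \<le> Z t \<omega>" if "s \<le> u" "u \<le> t"
    using * [OF that] mono_onD [of "{s..}" "\<lambda>t. Y t \<omega>" u t] that by simp
qed

text \<open>After the last visit to the barrier the process moves freely; if it was never pushed, it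
  has moved freely from \<open>y\<close>. This is the Skorokhod representation in the form that
  \<open>walk_eventually_ge\<close> takes.\<close>

lemma reflected_BM_attained:
  assumes Z: "reflected_BM F B \<theta> \<sigma> s r y Z Y" and \<omega>: "\<omega> \<in> space M" and t: "s \<le> t"
  shows "Z t \<omega> = y \<omega> + incr s t \<omega> \<or> (\<exists>u\<in>{s..t}. Z t \<omega> = r \<omega> + incr u t \<omega>)"
proof -
  have \<omega>': "\<omega> \<in> space (F s)"
    using Z \<omega> space_F by (simp add: reflected_BM_def)
  have Y0: "Y s \<omega> = 0"
    using Z \<omega>' unfolding reflected_BM_def by blast
  have "Y t \<omega> = 0 \<or> (\<exists>u\<in>{s..t}. Z u \<omega> = r \<omega> \<and> Y u \<omega> = Y t \<omega>)"
  proof (rule reflection_attained [OF t])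
    show "continuous_on {s..} (\<lambda>t. Z t \<omega>)" "continuous_on {s..} (\<lambda>t. Y t \<omega>)" "mono_on {s..} (\<lambda>t. Y t \<omega>)"
      using Z \<omega>' unfolding reflected_BM_def by blast+
    show "(LINT u:{s..t}|interval_measure (\<lambda>v. Y (max s v) \<omega>). indicat_real {v. r \<omega> < Z v \<omega>} u) = 0"
      using Z \<omega>' t unfolding reflected_BM_def by blast
  qed (use Y0 reflected_BM_ge(1) [OF Z \<omega>] in auto)
  then show ?thesis
  proof
    assume "Y t \<omega> = 0"
    then show ?thesis
      using reflected_BM_ge(2) [OF Z \<omega> t] reflected_BM_ge(3) [OF Z \<omega> t, of s] t Y0 by simp
  next
    assume "\<exists>u\<in>{s..t}. Z u \<omega> = r \<omega> \<and> Y u \<omega> = Y t \<omega>"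
    then obtain u where "u \<in> {s..t}" "Z u \<omega> = r \<omega>" "Y u \<omega> = Y t \<omega>"
      by blast
    then show ?thesis
      using reflected_BM_ge(3) [OF Z \<omega> t, of u] by (intro disjI2 bexI [of _ u]) auto
  qed
qed

lemma reflected_BM_measurable:
  assumes Z: "reflected_BM F B \<theta> \<sigma> s r y Z Y"
  shows "0 \<le> s" "r \<in> borel_measurable (F s)" "y \<in> borel_measurable (F s)"
    "s \<le> t \<Longrightarrow> Z t \<in> borel_measurable M"
    "\<omega> \<in> space M \<Longrightarrow> r \<omega> \<le> y \<omega>" "\<omega> \<in> space M \<Longrightarrow> continuous_on {s..} (\<lambda>t. Z t \<omega>)"
proof -
  show s: "0 \<le> s" "r \<in> borel_measurable (F s)" "y \<in> borel_measurable (F s)"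
    using Z by (simp_all add: reflected_BM_def)
  show "Z t \<in> borel_measurable M" if "s \<le> t"
    using Z that s unfolding reflected_BM_def by (intro measurable_F_M [of t]) auto
  show "r \<omega> \<le> y \<omega>" "continuous_on {s..} (\<lambda>t. Z t \<omega>)" if "\<omega> \<in> space M"
    using Z that space_F [OF s(1)] unfolding reflected_BM_def by auto
qed

text \<open>\<open>Z\<close> is pushed at all times, the walk only at grid times. By induction,
  \<open>Z\<close> lies above both terms of the maximum that defines the next walk value.\<close>

lemma walk_le_reflected_BM:
  assumes Z: "reflected_BM F B \<theta> \<sigma> s r y Z Y" and \<omega>: "\<omega> \<in> space M" and \<delta>: "0 \<le> \<delta>"
  shows "walk s \<delta> (\<lambda>\<omega>. y \<omega> - r \<omega>) i \<omega> \<le> Z (s + i * \<delta>) \<omega> - r \<omega>"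
proof (induction i)
  case 0
  then show ?case using reflected_BM_ge(2) [OF Z \<omega>, of s] by simp
next
  case (Suc i)
  have "Z (s + i * \<delta>) \<omega> + incr (s + i * \<delta>) (s + Suc i * \<delta>) \<omega> \<le> Z (s + Suc i * \<delta>) \<omega>"
    using \<delta> by (intro reflected_BM_ge(4) [OF Z \<omega>]) (auto simp: algebra_simps)
  moreover have "r \<omega> \<le> Z (s + Suc i * \<delta>) \<omega>"
    using \<delta> by (intro reflected_BM_ge(1) [OF Z \<omega>]) simp
  ultimately show ?case using Suc by simp
qed

text \<open>Every walk is below the limit; the free path that attains the limit supplies the
  matching eventual lower bound.\<close>

lemma walk_tendsto_reflected_BM:
  assumes Z: "reflected_BM F B \<theta> \<sigma> s r y Z Y" and \<omega>: "\<omega> \<in> space M" and t: "s < t"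
  shows "walk s ((t - s) / Suc n) (\<lambda>\<omega>. y \<omega> - r \<omega>) (Suc n) \<omega> \<le> Z t \<omega> - r \<omega>"
    and "(\<lambda>n. walk s ((t - s) / Suc n) (\<lambda>\<omega>. y \<omega> - r \<omega>) (Suc n) \<omega>) \<longlonglongrightarrow> Z t \<omega> - r \<omega>"
proof -
  let ?V = "\<lambda>\<omega>. y \<omega> - r \<omega>"
  have le: "walk s ((t - s) / Suc n) ?V (Suc n) \<omega> \<le> Z t \<omega> - r \<omega>" for n
    using walk_le_reflected_BM [OF Z \<omega>, of "(t - s) / Suc n" "Suc n"] t by (simp del: walk.simps of_nat_Suc)
  then show "walk s ((t - s) / Suc n) ?V (Suc n) \<omega> \<le> Z t \<omega> - r \<omega>" .
  have q: "Z t \<omega> - r \<omega> \<le> ?V \<omega> + incr s t \<omega> \<or> (\<exists>u\<in>{s..t}. Z t \<omega> - r \<omega> \<le> incr u t \<omega>)"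
    using reflected_BM_attained [OF Z \<omega>, of t] t by force
  have V: "0 \<le> ?V \<omega>" and s: "0 \<le> s"
    using reflected_BM_measurable [OF Z] \<omega> by auto
  show "(\<lambda>n. walk s ((t - s) / Suc n) ?V (Suc n) \<omega>) \<longlonglongrightarrow> Z t \<omega> - r \<omega>"
  proof (rule order_tendstoI)
    fix a assume "a < Z t \<omega> - r \<omega>"
    then show "\<forall>\<^sub>F n in sequentially. a < walk s ((t - s) / Suc n) ?V (Suc n) \<omega>"
      using walk_eventually_ge [where V = ?V, OF \<omega> s t V q, of "Z t \<omega> - r \<omega> - a"] by (simp del: walk.simps of_nat_Suc)
  next
    fix a assume "Z t \<omega> - r \<omega> < a"
    then show "\<forall>\<^sub>F n in sequentially. walk s ((t - s) / Suc n) ?V (Suc n) \<omega> < a"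
      by (intro always_eventually allI le_less_trans [OF le])
  qed
qed

text \<open>Stated for any \<open>q\<close> below a path reflected at 0, so that it serves both the
  distance to one barrier and the starting states of the phases, whose barriers change.\<close>

lemma nn_integral_exp_reflected_le:
  assumes s: "0 \<le> s" "s < t" and l: "0 < l" "2 * l \<le> \<gamma>"
    and V: "V \<in> borel_measurable (F s)" and V0: "\<And>\<omega>. \<omega> \<in> space M \<Longrightarrow> 0 \<le> V \<omega>"
    and q_meas: "q \<in> borel_measurable M"
    and q: "\<And>\<omega>. \<omega> \<in> space M \<Longrightarrow> q \<omega> \<le> V \<omega> + incr s t \<omega> \<or> (\<exists>u\<in>{s..t}. q \<omega> \<le> incr u t \<omega>)"
  shows "(\<integral>\<^sup>+\<omega>. ennreal (exp (l * q \<omega>)) \<partial>M) \<le> (\<integral>\<^sup>+\<omega>. ennreal (exp (l * V \<omega>)) \<partial>M) + 4"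
proof -
  interpret prob_space M by (rule prob_space_M)
  let ?w = "\<lambda>n. walk s ((t - s) / Suc n) V (Suc n)"
  \<comment> \<open>The walks are only known to exceed \<open>q\<close> in the limit, up to any
    error; their minimum with \<open>q\<close> does converge to \<open>q\<close>, which suits
    Fatou.\<close>
  let ?u = "\<lambda>n \<omega>. ennreal (exp (l * min (?w n \<omega>) (q \<omega>)))"
  have V_M [measurable]: "V \<in> borel_measurable M"
    by (rule measurable_F_M [OF s(1) V])
  note q_meas [measurable]
  have [measurable]: "?w n \<in> borel_measurable M" for n
    using s by (intro walk_measurable V) auto
  show ?thesis
  proof (rule nn_integral_tendsto_le [where u = ?u])
    show "?u n \<in> borel_measurable M" for n
      by measurable
    fix \<omega> assume \<omega>: "\<omega> \<in> space M"
    have "(\<lambda>n. min (?w n \<omega>) (q \<omega>)) \<longlonglongrightarrow> q \<omega>"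
    proof (rule order_tendstoI)
      fix a assume "a < q \<omega>"
      then have "\<forall>\<^sub>F n in sequentially. a < ?w n \<omega>"
        using walk_eventually_ge [OF \<omega> s, of V "q \<omega>" "q \<omega> - a", OF V0 [OF \<omega>] q [OF \<omega>]] by (simp del: walk.simps of_nat_Suc)
      then show "\<forall>\<^sub>F n in sequentially. a < min (?w n \<omega>) (q \<omega>)"
        using \<open>a < q \<omega>\<close> by (auto elim: eventually_mono simp del: walk.simps of_nat_Suc)
    next
      fix a assume "q \<omega> < a"
      then show "\<forall>\<^sub>F n in sequentially. min (?w n \<omega>) (q \<omega>) < a"
        by (intro always_eventually allI) (simp add: min_less_iff_disj del: walk.simps of_nat_Suc)
    qed
    then show "(\<lambda>n. ?u n \<omega>) \<longlonglongrightarrow> ennreal (exp (l * q \<omega>))"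
      by (intro tendsto_intros)
  next
    fix n
    have "(\<integral>\<^sup>+\<omega>. ?u n \<omega> \<partial>M) \<le> (\<integral>\<^sup>+\<omega>. ennreal (exp (l * max (?w n \<omega>) 0)) \<partial>M)"
      using l by (intro nn_integral_mono ennreal_leI) (auto simp del: walk.simps)
    also have "\<dots> = (\<integral>\<^sup>+\<omega>. (P ((t - s) / Suc n) ^^ Suc n) (\<lambda>v. ennreal (exp (l * max v 0))) (V \<omega>) \<partial>M)"
      using s by (intro nn_integral_walk [where f = "\<lambda>r v. ennreal (exp (l * max v 0))" and R = "\<lambda>_. 0"] V) auto
    also have "\<dots> \<le> (\<integral>\<^sup>+\<omega>. ennreal (exp (l * V \<omega>)) + 4 \<partial>M)"
      using s l V0 by (intro nn_integral_mono funpow_reflect_op_exp_le) auto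
    also have "\<dots> = (\<integral>\<^sup>+\<omega>. ennreal (exp (l * V \<omega>)) \<partial>M) + 4"
      using emeasure_space_1 by (simp add: nn_integral_add)
    finally show "(\<integral>\<^sup>+\<omega>. ?u n \<omega> \<partial>M) \<le> (\<integral>\<^sup>+\<omega>. ennreal (exp (l * V \<omega>)) \<partial>M) + 4" .
  qed
qed

end

subsection \<open>Convergence of the mean cost\<close>

text \<open>\<open>l\<close>, \<open>C\<close> and \<open>K\<close> will be
  \<open>\<gamma>min / 2\<close>, \<open>Ch\<close> and \<open>Kh\<close>. The exponent
  \<open>l\<close> governs the contraction; the smaller \<open>b\<close> satisfies
  \<open>2 * b < \<gamma>\<close>, as the second moments in \<open>nn_integral_nu_tendsto\<close>
  require.\<close>

locale cost_BM = driven_BM +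
  fixes h :: "real \<Rightarrow> real" and l b C K :: real
  assumes h_cont: "continuous_on UNIV h" and h_nonneg: "0 \<le> h z"
    and b_pos: "0 < b" and b_less: "b < l" and l_le: "2 * l \<le> \<gamma>" and C_nonneg: "0 \<le> C"
    and h_le_b: "r \<in> {- K..0} \<Longrightarrow> 0 \<le> v \<Longrightarrow> h (r + v) \<le> C * exp (b * v)"
begin

lemma h_measurable [measurable]: "h \<in> borel_measurable borel"
  by (rule borel_measurable_continuous_onI [OF h_cont])

lemma l_pos: "0 < l"
  using b_pos b_less by simp

lemma rate_pos: "0 < rate l"
  using l_pos l_le gamma_pos sigma_pos by (simp add: rate_def)

lemma h_le_l: "r \<in> {- K..0} \<Longrightarrow> 0 \<le> v \<Longrightarrow> h (r + v) \<le> C * exp (l * v)"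
  using b_less C_nonneg by (intro order_trans [OF h_le_b] mult_left_mono) (auto intro: mult_right_mono)

text \<open>\<open>cost_C h \<gamma> r\<close> is the stationary mean of \<open>h (r + V)\<close>
  with \<open>V\<close> of law \<open>expo\<close>, by the shift \<open>z = r + v\<close>. There
  \<open>max v 0\<close> equals \<open>v\<close> almost surely; it makes the growth bound on
  \<open>h\<close> applicable at every \<open>v\<close>.\<close>

lemma cost_C_eq: "cost_C h \<gamma> r = enn2real (\<integral>\<^sup>+v. ennreal (h (r + max v 0)) \<partial>expo)"
proof -
  let ?g = "\<lambda>z. indicator {r..} z * (\<gamma> * (h z * exp (- \<gamma> * (z - r))))"
  have "cost_C h \<gamma> r = (\<integral>z. ?g z \<partial>lborel)"
  proof -
    have g: "?g z = \<gamma> * (indicator {r..} z *\<^sub>R (h z * exp (- \<gamma> * (z - r))))" for z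
      by simp
    show ?thesis
      unfolding cost_C_def set_lebesgue_integral_def g by (rule integral_mult_right_zero [symmetric])
  qed
  also have "\<dots> = enn2real (\<integral>\<^sup>+z. ennreal (?g z) \<partial>lborel)"
    using gamma_pos by (intro integral_eq_nn_integral) (auto simp: h_nonneg)
  also have "(\<integral>\<^sup>+z. ennreal (?g z) \<partial>lborel) = (\<integral>\<^sup>+v. ennreal (?g (r + 1 * v)) \<partial>lborel)"
    by (subst nn_integral_real_affine [where c = 1 and t = r]) auto
  also have "\<dots> = (\<integral>\<^sup>+v. ennreal (exponential_density \<gamma> v) * ennreal (h (r + max v 0)) \<partial>lborel)"
    using gamma_pos
    by (intro nn_integral_cong)
       (auto simp: ennreal_mult' [symmetric] exponential_density_def indicator_def max_def mult_ac h_nonneg)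
  also have "\<dots> = (\<integral>\<^sup>+v. ennreal (h (r + max v 0)) \<partial>expo)"
    by (subst nn_integral_density) auto
  finally show ?thesis .
qed

lemma nn_integral_h_nu_le:
  assumes \<delta>: "0 < \<delta>" and r: "r \<in> {- K..0}"
  shows "(\<integral>\<^sup>+v. ennreal (h (r + max v 0)) \<partial>nu \<delta> n) \<le> ennreal (2 * C)"
proof -
  have "(\<integral>\<^sup>+v. ennreal (h (r + max v 0)) \<partial>nu \<delta> n) \<le> (\<integral>\<^sup>+v. ennreal C * ennreal (exp (l * max v 0)) \<partial>nu \<delta> n)"
    using C_nonneg h_le_l [OF r] by (intro nn_integral_mono) (simp add: ennreal_mult' [symmetric] ennreal_leI)
  also have "\<dots> \<le> ennreal C * 2"
    by (subst nn_integral_cmult) (auto intro!: mult_left_mono nn_integral_exp_nu_le_2 \<delta> l_pos l_le)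
  also have "\<dots> = ennreal (2 * C)"
    using C_nonneg by (simp add: ennreal_mult' mult.commute)
  finally show ?thesis .
qed

lemma ennreal_cost_C:
  assumes "r \<in> {- K..0}"
  shows "ennreal (cost_C h \<gamma> r) = (\<integral>\<^sup>+v. ennreal (h (r + max v 0)) \<partial>expo)"
  \<comment> \<open>\<open>nu 1 0\<close> is \<open>expo\<close>, the step length 1 being arbitrary;
    the bound gives the finiteness that undoes \<open>enn2real\<close>.\<close>
  using nn_integral_h_nu_le [of 1 r 0] assms unfolding cost_C_eq nu_0
  by (intro ennreal_enn2real) (auto intro: le_less_trans)

lemma cost_C_nonneg: "0 \<le> cost_C h \<gamma> r"
  by (simp add: cost_C_eq)

lemma cost_C_le: "r \<in> {- K..0} \<Longrightarrow> cost_C h \<gamma> r \<le> 2 * C"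
  using nn_integral_h_nu_le [of 1 r 0] C_nonneg unfolding cost_C_eq nu_0
  by (intro enn2real_leI) auto

lemma cost_C_measurable [measurable]: "cost_C h \<gamma> \<in> borel_measurable borel"
proof -
  interpret prob_space expo
    using gamma_pos by (rule prob_space_exponential_density)
  show ?thesis
    unfolding cost_C_eq [abs_def] by measurable
qed

text \<open>On each grid the mean cost \<open>?a n\<close> of the walk and the mean cost
  \<open>?b n\<close> of the exponential start differ by at most \<open>?e\<close>, which does not
  depend on \<open>n\<close>. Dominated convergence sends them to the two sides of the
  claim.\<close>

lemma mean_cost_bound:
  assumes Z: "reflected_BM F B \<theta> \<sigma> s r y Z Y" and r: "\<And>\<omega>. \<omega> \<in> space M \<Longrightarrow> r \<omega> \<in> {- K..0}"
    and w: "0 \<le> w" "(\<integral>\<^sup>+\<omega>. ennreal (exp (l * (y \<omega> - r \<omega>))) \<partial>M) \<le> ennreal w" and t: "s < t"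
  shows "(\<integral>\<^sup>+\<omega>. ennreal (h (Z t \<omega>)) \<partial>M)
      \<le> (\<integral>\<^sup>+\<omega>. ennreal (cost_C h \<gamma> (r \<omega>)) \<partial>M) + ennreal (C * exp (- rate l * (t - s)) * (w + 2))"
    and "(\<integral>\<^sup>+\<omega>. ennreal (cost_C h \<gamma> (r \<omega>)) \<partial>M)
      \<le> (\<integral>\<^sup>+\<omega>. ennreal (h (Z t \<omega>)) \<partial>M) + ennreal (C * exp (- rate l * (t - s)) * (w + 2))"
proof -
  interpret prob_space M by (rule prob_space_M)
  let ?V = "\<lambda>\<omega>. y \<omega> - r \<omega>"
  let ?\<delta> = "\<lambda>n. (t - s) / Suc n"
  let ?w = "\<lambda>n. walk s (?\<delta> n) ?V (Suc n)"
  let ?f = "\<lambda>r v. ennreal (h (r + max v 0))"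
  let ?c = "ennreal (C * exp (- rate l * (t - s)))"
  let ?e = "ennreal (C * exp (- rate l * (t - s)) * (w + 2))"
  let ?a = "\<lambda>n. \<integral>\<^sup>+\<omega>. ?f (r \<omega>) (?w n \<omega>) \<partial>M"
  let ?b = "\<lambda>n. \<integral>\<^sup>+\<omega>. (\<integral>\<^sup>+v. ?f (r \<omega>) v \<partial>nu (?\<delta> n) (Suc n)) \<partial>M"
  note meas = reflected_BM_measurable [OF Z]
  have \<delta>: "0 < ?\<delta> n" for n
    using t by simp
  have [measurable]: "r \<in> borel_measurable M" "y \<in> borel_measurable M" "Z t \<in> borel_measurable M"
    using meas t by (auto intro: measurable_F_M)
  have V_F: "?V \<in> borel_measurable (F s)"
    using meas by measurable
  have w_meas [measurable]: "?w n \<in> borel_measurable M" for n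
    using t meas by (intro walk_measurable V_F) auto
  have V0: "0 \<le> ?V \<omega>" if "\<omega> \<in> space M" for \<omega>
    using meas(5) [OF that] by simp
  have f_meas: "?f r \<in> borel_measurable borel" for r
    by measurable
  have f_le: "?f r v \<le> ennreal (C * exp (l * v))" if "r \<in> {- K..0}" "0 \<le> v" for r v
    using h_le_l [OF that] that by (intro ennreal_leI) (simp add: max_def)
  \<comment> \<open>As \<open>h\<close> is nonnegative, its growth bound alone controls the
    oscillation.\<close>
  have osc: "?f r v \<le> ?f r v' + ennreal (C * exp (l * max v v'))" if "r \<in> {- K..0}" "0 \<le> v" "0 \<le> v'" for r v v'
    using C_nonneg l_pos f_le [OF that(1,2)]
    by (intro add_increasing order_trans [OF f_le [OF that(1,2)]] ennreal_leI mult_left_mono) auto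
  have a_eq: "?a n = (\<integral>\<^sup>+\<omega>. (P (?\<delta> n) ^^ Suc n) (?f (r \<omega>)) (?V \<omega>) \<partial>M)" for n
    using meas by (intro nn_integral_walk V_F \<delta>) auto
  have P_meas [measurable]: "(\<lambda>\<omega>. (P (?\<delta> n) ^^ k) (?f (r \<omega>)) (?V \<omega>)) \<in> borel_measurable M" for n k
  proof -
    have "(\<lambda>(r, v). (P (?\<delta> n) ^^ k) (?f r) v) \<in> borel_measurable (borel \<Otimes>\<^sub>M borel)"
    proof (induction k)
      case (Suc k)
      show ?case
        using measurable_reflect_op_param [OF \<delta> Suc] by simp
    qed simp
    then have "(\<lambda>\<omega>. case (r \<omega>, ?V \<omega>) of (r, v) \<Rightarrow> (P (?\<delta> n) ^^ k) (?f r) v) \<in> borel_measurable M"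
      by measurable
    then show ?thesis by simp
  qed
  have nu_meas [measurable]: "(\<lambda>\<omega>. \<integral>\<^sup>+v. ?f (r \<omega>) v \<partial>nu (?\<delta> n) k) \<in> borel_measurable M" for n k
  proof -
    interpret N: prob_space "nu (?\<delta> n) k" by (rule prob_space_nu [OF \<delta>])
    show ?thesis by measurable
  qed
  \<comment> \<open>Each grid ends exactly at \<open>t\<close>, so the decay factor is the same for
    all \<open>n\<close>.\<close>
  have pow: "real (Suc n) * ?\<delta> n = t - s" for n
    by (simp del: of_nat_Suc)
  have c_int: "(\<integral>\<^sup>+\<omega>. ?c * (ennreal (exp (l * ?V \<omega>)) + 2) \<partial>M) \<le> ?e"
  proof -
    have "(\<integral>\<^sup>+\<omega>. ?c * (ennreal (exp (l * ?V \<omega>)) + 2) \<partial>M) = ?c * ((\<integral>\<^sup>+\<omega>. ennreal (exp (l * ?V \<omega>)) \<partial>M) + 2)"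
      using emeasure_space_1 by (simp add: nn_integral_cmult nn_integral_add)
    also have "\<dots> \<le> ?c * (ennreal w + 2)"
      by (intro mult_left_mono add_right_mono w) simp
    also have "ennreal w + 2 = ennreal (w + 2)"
      using w by simp
    also have "?c * ennreal (w + 2) = ?e"
      using C_nonneg by (intro ennreal_mult' [symmetric]) simp
    finally show ?thesis .
  qed
  have a_le: "?a n \<le> ?b n + ?e" for n
  proof -
    have "?a n \<le> (\<integral>\<^sup>+\<omega>. (\<integral>\<^sup>+v. ?f (r \<omega>) v \<partial>nu (?\<delta> n) (Suc n)) + ?c * (ennreal (exp (l * ?V \<omega>)) + 2) \<partial>M)"
      unfolding a_eq
    proof (intro nn_integral_mono)
      fix \<omega> assume \<omega>: "\<omega> \<in> space M"
      show "(P (?\<delta> n) ^^ Suc n) (?f (r \<omega>)) (?V \<omega>)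
          \<le> (\<integral>\<^sup>+v. ?f (r \<omega>) v \<partial>nu (?\<delta> n) (Suc n)) + ?c * (ennreal (exp (l * ?V \<omega>)) + 2)"
        using funpow_reflect_op_near_nu(1) [where n = "Suc n" and f = "?f (r \<omega>)",
            OF \<delta> [of n] l_pos l_le C_nonneg f_meas osc [OF r [OF \<omega>]] V0 [OF \<omega>]]
        by (simp only: pow)
    qed
    also have "\<dots> = ?b n + (\<integral>\<^sup>+\<omega>. ?c * (ennreal (exp (l * ?V \<omega>)) + 2) \<partial>M)"
      by (rule nn_integral_add) measurable
    also have "\<dots> \<le> ?b n + ?e"
      by (intro add_left_mono c_int)
    finally show ?thesis .
  qed
  have b_le: "?b n \<le> ?a n + ?e" for n
  proof -
    have "?b n \<le> (\<integral>\<^sup>+\<omega>. (P (?\<delta> n) ^^ Suc n) (?f (r \<omega>)) (?V \<omega>) + ?c * (ennreal (exp (l * ?V \<omega>)) + 2) \<partial>M)"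
    proof (intro nn_integral_mono)
      fix \<omega> assume \<omega>: "\<omega> \<in> space M"
      show "(\<integral>\<^sup>+v. ?f (r \<omega>) v \<partial>nu (?\<delta> n) (Suc n))
          \<le> (P (?\<delta> n) ^^ Suc n) (?f (r \<omega>)) (?V \<omega>) + ?c * (ennreal (exp (l * ?V \<omega>)) + 2)"
        using funpow_reflect_op_near_nu(2) [where n = "Suc n" and f = "?f (r \<omega>)",
            OF \<delta> [of n] l_pos l_le C_nonneg f_meas osc [OF r [OF \<omega>]] V0 [OF \<omega>]]
        by (simp only: pow)
    qed
    also have "\<dots> = ?a n + (\<integral>\<^sup>+\<omega>. ?c * (ennreal (exp (l * ?V \<omega>)) + 2) \<partial>M)"
      unfolding a_eq by (rule nn_integral_add) measurable
    also have "\<dots> \<le> ?a n + ?e"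
      by (intro add_left_mono c_int)
    finally show ?thesis .
  qed
  have a_lim: "?a \<longlonglongrightarrow> (\<integral>\<^sup>+\<omega>. ennreal (h (Z t \<omega>)) \<partial>M)"
  \<comment> \<open>The walks lie below \<open>Z t \<omega> - r \<omega>\<close>, whose exponential
    moment is finite; this gives one dominating function for all \<open>n\<close>.\<close>
  proof (rule nn_integral_dominated_convergence [where w = "\<lambda>\<omega>. ennreal C * ennreal (exp (l * (Z t \<omega> - r \<omega>)))"])
    show "AE \<omega> in M. ?f (r \<omega>) (?w n \<omega>) \<le> ennreal C * ennreal (exp (l * (Z t \<omega> - r \<omega>)))" for n
    proof (intro AE_I2)
      fix \<omega> assume \<omega>: "\<omega> \<in> space M"
      have "?f (r \<omega>) (?w n \<omega>) \<le> ennreal (C * exp (l * ?w n \<omega>))"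
        by (intro f_le r \<omega> walk_nonneg V0)
      also have "\<dots> \<le> ennreal (C * exp (l * (Z t \<omega> - r \<omega>)))"
        using walk_tendsto_reflected_BM(1) [OF Z \<omega> t, of n] C_nonneg l_pos
        by (intro ennreal_leI mult_left_mono) (auto simp del: walk.simps of_nat_Suc)
      also have "\<dots> = ennreal C * ennreal (exp (l * (Z t \<omega> - r \<omega>)))"
        using C_nonneg by (rule ennreal_mult')
      finally show "?f (r \<omega>) (?w n \<omega>) \<le> ennreal C * ennreal (exp (l * (Z t \<omega> - r \<omega>)))" .
    qed
    have "(\<integral>\<^sup>+\<omega>. ennreal (exp (l * (Z t \<omega> - r \<omega>))) \<partial>M) \<le> (\<integral>\<^sup>+\<omega>. ennreal (exp (l * ?V \<omega>)) \<partial>M) + 4"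
    proof (rule nn_integral_exp_reflected_le [OF meas(1) t l_pos l_le V_F V0])
      fix \<omega> assume \<omega>: "\<omega> \<in> space M"
      show "Z t \<omega> - r \<omega> \<le> ?V \<omega> + incr s t \<omega> \<or> (\<exists>u\<in>{s..t}. Z t \<omega> - r \<omega> \<le> incr u t \<omega>)"
        using reflected_BM_attained [OF Z \<omega>, of t] t by force
    qed simp_all
    also have "\<dots> \<le> ennreal w + 4"
      by (intro add_right_mono w)
    also have "\<dots> < \<infinity>"
      by simp
    finally show "(\<integral>\<^sup>+\<omega>. ennreal C * ennreal (exp (l * (Z t \<omega> - r \<omega>))) \<partial>M) < \<infinity>"
      by (simp add: nn_integral_cmult ennreal_mult_less_top)
    show "AE \<omega> in M. (\<lambda>n. ?f (r \<omega>) (?w n \<omega>)) \<longlonglongrightarrow> ennreal (h (Z t \<omega>))"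
    proof (intro AE_I2)
      fix \<omega> assume \<omega>: "\<omega> \<in> space M"
      have "(\<lambda>n. r \<omega> + max (?w n \<omega>) 0) \<longlonglongrightarrow> r \<omega> + max (Z t \<omega> - r \<omega>) 0"
        by (intro tendsto_intros walk_tendsto_reflected_BM(2) [OF Z \<omega> t])
      also have "r \<omega> + max (Z t \<omega> - r \<omega>) 0 = Z t \<omega>"
        using reflected_BM_ge(1) [OF Z \<omega>, of t] t by simp
      finally have lim: "(\<lambda>n. r \<omega> + max (?w n \<omega>) 0) \<longlonglongrightarrow> Z t \<omega>" .
      show "(\<lambda>n. ?f (r \<omega>) (?w n \<omega>)) \<longlonglongrightarrow> ennreal (h (Z t \<omega>))"
        by (rule tendsto_ennrealI, rule continuous_on_tendsto_compose [OF h_cont lim]) simp_all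
    qed
  qed measurable
  have b_lim: "?b \<longlonglongrightarrow> (\<integral>\<^sup>+\<omega>. ennreal (cost_C h \<gamma> (r \<omega>)) \<partial>M)"
  proof (rule nn_integral_dominated_convergence [where w = "\<lambda>\<omega>. ennreal (2 * C)"])
    show "AE \<omega> in M. (\<integral>\<^sup>+v. ?f (r \<omega>) v \<partial>nu (?\<delta> n) (Suc n)) \<le> ennreal (2 * C)" for n
      by (intro AE_I2 nn_integral_h_nu_le \<delta> r)
    show "(\<integral>\<^sup>+\<omega>. ennreal (2 * C) \<partial>M) < \<infinity>"
      using emeasure_space_1 by simp
    show "AE \<omega> in M. (\<lambda>n. \<integral>\<^sup>+v. ?f (r \<omega>) v \<partial>nu (?\<delta> n) (Suc n)) \<longlonglongrightarrow> ennreal (cost_C h \<gamma> (r \<omega>))"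
    proof (intro AE_I2)
      fix \<omega> assume \<omega>: "\<omega> \<in> space M"
      show "(\<lambda>n. \<integral>\<^sup>+v. ?f (r \<omega>) v \<partial>nu (?\<delta> n) (Suc n)) \<longlonglongrightarrow> ennreal (cost_C h \<gamma> (r \<omega>))"
        unfolding ennreal_cost_C [OF r [OF \<omega>]]
      proof (rule nn_integral_nu_tendsto [where A = C and \<beta> = b])
        show "continuous_on UNIV (\<lambda>v. h (r \<omega> + max v 0))"
          by (intro continuous_on_compose2 [OF h_cont] continuous_intros) auto
        show "h (r \<omega> + max v 0) \<le> C * exp (b * max v 0)" for v
          by (intro h_le_b r \<omega>) simp
      qed (use t b_pos b_less l_le h_nonneg in auto)
    qed
  qed measurable
  show "(\<integral>\<^sup>+\<omega>. ennreal (h (Z t \<omega>)) \<partial>M) \<le> (\<integral>\<^sup>+\<omega>. ennreal (cost_C h \<gamma> (r \<omega>)) \<partial>M) + ?e"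
    by (rule LIMSEQ_le [OF a_lim tendsto_add [OF b_lim tendsto_const]]) (use a_le in blast)
  show "(\<integral>\<^sup>+\<omega>. ennreal (cost_C h \<gamma> (r \<omega>)) \<partial>M) \<le> (\<integral>\<^sup>+\<omega>. ennreal (h (Z t \<omega>)) \<partial>M) + ?e"
    by (rule LIMSEQ_le [OF b_lim tendsto_add [OF a_lim tendsto_const]]) (use b_le in blast)
qed

section \<open>Cost accumulated over a time interval\<close>

text \<open>Fubini exchanges time and expectation, and the decaying error integrates over all times
  after \<open>s\<close> to \<open>C * (w + 2) / rate l\<close>. Hence the bound does not depend on
  the length of the interval.\<close>

lemma integrated_cost_bound:
  assumes Z: "reflected_BM F B \<theta> \<sigma> s r y Z Y" and r: "\<And>\<omega>. \<omega> \<in> space M \<Longrightarrow> r \<omega> \<in> {- K..0}"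
    and w: "0 \<le> w" "(\<integral>\<^sup>+\<omega>. ennreal (exp (l * (y \<omega> - r \<omega>))) \<partial>M) \<le> ennreal w"
  shows "integrable M (\<lambda>\<omega>. LINT u:{s..t}|lborel. h (Z u \<omega>) - cost_C h \<gamma> (r \<omega>))"
    and "\<bar>\<integral>\<omega>. (LINT u:{s..t}|lborel. h (Z u \<omega>) - cost_C h \<gamma> (r \<omega>)) \<partial>M\<bar> \<le> C * (w + 2) / rate l"
proof -
  interpret prob_space M by (rule prob_space_M)
  interpret LM: pair_sigma_finite lborel M ..
  note meas = reflected_BM_measurable [OF Z]
  \<comment> \<open>\<open>max s u\<close> makes the integrand jointly measurable for all
    \<open>u\<close>; the indicator removes the times before \<open>s\<close>.\<close>
  let ?G = "\<lambda>u \<omega>. indicator {s..t} u *\<^sub>R (h (Z (max s u) \<omega>) - cost_C h \<gamma> (r \<omega>))"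
  let ?e = "\<lambda>u. C * exp (- rate l * (u - s)) * (w + 2)"
  have [measurable]: "r \<in> borel_measurable M"
    using meas by (auto intro: measurable_F_M)
  have Z_meas: "(\<lambda>p. Z (max s (fst p)) (snd p)) \<in> borel_measurable (borel \<Otimes>\<^sub>M M)"
    by (intro borel_measurable_continuous_process meas)
  then have [measurable]: "(\<lambda>p. Z (max s (fst p)) (snd p)) \<in> borel_measurable (lborel \<Otimes>\<^sub>M M)"
    by (subst measurable_cong_sets [OF sets_pair_measure_cong [OF sets_lborel refl] refl])
  have G_meas: "case_prod ?G \<in> borel_measurable (lborel \<Otimes>\<^sub>M M)"
    unfolding case_prod_beta' by measurable
  have LINT_eq: "(LINT u:{s..t}|lborel. h (Z u \<omega>) - cost_C h \<gamma> (r \<omega>)) = (\<integral>u. ?G u \<omega> \<partial>lborel)" for \<omega>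
    unfolding set_lebesgue_integral_def by (intro Bochner_Integration.integral_cong) (auto simp: indicator_def)
  have cost_int: "(\<integral>\<^sup>+\<omega>. ennreal (cost_C h \<gamma> (r \<omega>)) \<partial>M) \<le> ennreal (2 * C)"
  proof -
    have "(\<integral>\<^sup>+\<omega>. ennreal (cost_C h \<gamma> (r \<omega>)) \<partial>M) \<le> (\<integral>\<^sup>+\<omega>. ennreal (2 * C) \<partial>M)"
      by (intro nn_integral_mono ennreal_leI cost_C_le r)
    then show ?thesis using emeasure_space_1 by simp
  qed
  have e_le: "?e u \<le> C * (w + 2)" if "s \<le> u" for u
  proof -
    have "exp (- rate l * (u - s)) \<le> 1"
      using rate_pos that by simp
    then have "C * exp (- rate l * (u - s)) * (w + 2) \<le> C * 1 * (w + 2)"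
      using C_nonneg w by (intro mult_right_mono mult_left_mono) auto
    then show ?thesis by simp
  qed
  have h_int: "(\<integral>\<^sup>+\<omega>. ennreal (h (Z u \<omega>)) \<partial>M) \<le> ennreal (2 * C + C * (w + 2))" if "s < u" for u
  proof -
    have "(\<integral>\<^sup>+\<omega>. ennreal (h (Z u \<omega>)) \<partial>M) \<le> (\<integral>\<^sup>+\<omega>. ennreal (cost_C h \<gamma> (r \<omega>)) \<partial>M) + ennreal (?e u)"
      by (rule mean_cost_bound(1) [OF Z r w that])
    also have "\<dots> \<le> ennreal (2 * C) + ennreal (C * (w + 2))"
      using that by (intro add_mono cost_int ennreal_leI e_le) auto
    finally show ?thesis
      using C_nonneg w by simp
  qed
  \<comment> \<open>A crude bound, for integrability on the product space; the decaying one is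
    \<open>mean_le\<close>. Both leave out the null set \<open>u = s\<close>, as
    \<open>mean_cost_bound\<close> requires \<open>s < u\<close>.\<close>
  have norm_int: "(\<integral>\<^sup>+\<omega>. ennreal (norm (?G u \<omega>)) \<partial>M) \<le> ennreal (4 * C + C * (w + 2)) * indicator {s..t} u" if "u \<noteq> s" for u
  proof (cases "u \<in> {s..t}")
    case True
    with that have u: "s < u" by simp
    have [measurable]: "Z u \<in> borel_measurable M"
      using u by (intro meas) simp
    have "(\<integral>\<^sup>+\<omega>. ennreal (norm (?G u \<omega>)) \<partial>M) \<le> (\<integral>\<^sup>+\<omega>. ennreal (h (Z u \<omega>)) + ennreal (cost_C h \<gamma> (r \<omega>)) \<partial>M)"
    proof (intro nn_integral_mono)
      fix \<omega>
      have "norm (?G u \<omega>) \<le> h (Z u \<omega>) + cost_C h \<gamma> (r \<omega>)"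
        using True h_nonneg [of "Z u \<omega>"] cost_C_nonneg [of "r \<omega>"] by simp
      then have "ennreal (norm (?G u \<omega>)) \<le> ennreal (h (Z u \<omega>) + cost_C h \<gamma> (r \<omega>))"
        by (rule ennreal_leI)
      then show "ennreal (norm (?G u \<omega>)) \<le> ennreal (h (Z u \<omega>)) + ennreal (cost_C h \<gamma> (r \<omega>))"
        by (simp only: ennreal_plus h_nonneg cost_C_nonneg)
    qed
    also have "\<dots> = (\<integral>\<^sup>+\<omega>. ennreal (h (Z u \<omega>)) \<partial>M) + (\<integral>\<^sup>+\<omega>. ennreal (cost_C h \<gamma> (r \<omega>)) \<partial>M)"
      by (rule nn_integral_add) measurable
    also have "\<dots> \<le> ennreal (2 * C + C * (w + 2)) + ennreal (2 * C)"
      by (intro add_mono h_int cost_int u)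
    also have "\<dots> = ennreal (4 * C + C * (w + 2))"
      using C_nonneg w by (subst ennreal_plus [symmetric]) auto
    finally show ?thesis
      using True by simp
  qed simp
  have "(\<integral>\<^sup>+p. ennreal (norm (case_prod ?G p)) \<partial>(lborel \<Otimes>\<^sub>M M)) = (\<integral>\<^sup>+u. \<integral>\<^sup>+\<omega>. ennreal (norm (?G u \<omega>)) \<partial>M \<partial>lborel)"
    using G_meas by (subst nn_integral_fst [symmetric]) auto
  also have "\<dots> \<le> (\<integral>\<^sup>+u. ennreal (4 * C + C * (w + 2)) * indicator {s..t} u \<partial>lborel)"
    using AE_lborel_singleton [of s] norm_int by (intro nn_integral_mono_AE) (auto elim!: eventually_mono)
  also have "\<dots> < \<infinity>"
    by (simp add: nn_integral_cmult ennreal_mult_less_top emeasure_lborel_Icc_eq)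
  finally have G_int: "integrable (lborel \<Otimes>\<^sub>M M) (case_prod ?G)"
    using G_meas by (intro integrableI_bounded) auto
  show "integrable M (\<lambda>\<omega>. LINT u:{s..t}|lborel. h (Z u \<omega>) - cost_C h \<gamma> (r \<omega>))"
    unfolding LINT_eq by (rule LM.integrable_snd [OF G_int])
  have mean_le: "ennreal (norm (\<integral>\<omega>. ?G u \<omega> \<partial>M)) \<le> ennreal (?e u) * indicator {s..} u" if "u \<noteq> s" for u
  proof (cases "u \<in> {s..t}")
    case True
    with that have u: "s < u" by simp
    have [measurable]: "Z u \<in> borel_measurable M"
      using u by (intro meas) simp
    have int_h: "integrable M (\<lambda>\<omega>. h (Z u \<omega>))"
      using h_int [OF u] by (intro integrableI_nonneg) (auto simp: h_nonneg intro: le_less_trans)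
    have int_c: "integrable M (\<lambda>\<omega>. cost_C h \<gamma> (r \<omega>))"
      using cost_int by (intro integrableI_nonneg) (auto simp: cost_C_nonneg intro: le_less_trans)
    have e0: "0 \<le> ?e u"
      using C_nonneg w by simp
    have eq: "(\<integral>\<^sup>+\<omega>. ennreal (h (Z u \<omega>)) \<partial>M) = ennreal (\<integral>\<omega>. h (Z u \<omega>) \<partial>M)"
        "(\<integral>\<^sup>+\<omega>. ennreal (cost_C h \<gamma> (r \<omega>)) \<partial>M) = ennreal (\<integral>\<omega>. cost_C h \<gamma> (r \<omega>) \<partial>M)"
      using int_h int_c by (auto intro!: nn_integral_eq_integral simp: h_nonneg cost_C_nonneg)
    have nn: "0 \<le> (\<integral>\<omega>. h (Z u \<omega>) \<partial>M)" "0 \<le> (\<integral>\<omega>. cost_C h \<gamma> (r \<omega>) \<partial>M)"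
      by (auto intro!: integral_nonneg_AE simp: h_nonneg cost_C_nonneg)
    have cancel: "p \<le> q + e" if "ennreal p \<le> ennreal q + ennreal e" "0 \<le> q" "0 \<le> e" for p q e
      using that by (simp add: ennreal_le_iff flip: ennreal_plus)
    have "(\<integral>\<omega>. h (Z u \<omega>) \<partial>M) \<le> (\<integral>\<omega>. cost_C h \<gamma> (r \<omega>) \<partial>M) + ?e u"
      using mean_cost_bound(1) [OF Z r w u] unfolding eq by (intro cancel nn e0)
    moreover have "(\<integral>\<omega>. cost_C h \<gamma> (r \<omega>) \<partial>M) \<le> (\<integral>\<omega>. h (Z u \<omega>) \<partial>M) + ?e u"
      using mean_cost_bound(2) [OF Z r w u] unfolding eq by (intro cancel nn e0)
    moreover have "(\<integral>\<omega>. ?G u \<omega> \<partial>M) = (\<integral>\<omega>. h (Z u \<omega>) \<partial>M) - (\<integral>\<omega>. cost_C h \<gamma> (r \<omega>) \<partial>M)"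
      using True int_h int_c by simp
    ultimately have "norm (\<integral>\<omega>. ?G u \<omega> \<partial>M) \<le> ?e u"
      unfolding real_norm_def by linarith
    then show ?thesis
      using u by (simp add: ennreal_leI)
  qed simp
  have "(\<integral>\<omega>. (LINT u:{s..t}|lborel. h (Z u \<omega>) - cost_C h \<gamma> (r \<omega>)) \<partial>M) = (\<integral>u. \<integral>\<omega>. ?G u \<omega> \<partial>M \<partial>lborel)"
    unfolding LINT_eq by (rule LM.Fubini_integral [OF G_int])
  moreover have "ennreal (norm (\<integral>u. \<integral>\<omega>. ?G u \<omega> \<partial>M \<partial>lborel)) \<le> ennreal (C * (w + 2) / rate l)"
  proof -
    have "integrable lborel (\<lambda>u. \<integral>\<omega>. ?G u \<omega> \<partial>M)"
      by (rule LM.integrable_fst [OF G_int])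
    then have "ennreal (norm (\<integral>u. \<integral>\<omega>. ?G u \<omega> \<partial>M \<partial>lborel)) \<le> (\<integral>\<^sup>+u. ennreal (norm (\<integral>\<omega>. ?G u \<omega> \<partial>M)) \<partial>lborel)"
      by (rule integral_norm_bound_ennreal)
    also have "\<dots> \<le> (\<integral>\<^sup>+u. ennreal (?e u) * indicator {s..} u \<partial>lborel)"
      using AE_lborel_singleton [of s] mean_le by (intro nn_integral_mono_AE) (auto elim!: eventually_mono)
    also have "\<dots> = ennreal (0 - (- (C * (w + 2) / rate l) * exp (- rate l * (s - s))))"
    proof (rule nn_integral_FTC_atLeast [where F = "\<lambda>u. - (C * (w + 2) / rate l) * exp (- rate l * (u - s))"])
      show "((\<lambda>u. - (C * (w + 2) / rate l) * exp (- rate l * (u - s))) \<longlongrightarrow> 0) at_top"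
        using rate_pos by real_asymp
      have "((\<lambda>u. - (D / c) * exp (- c * (u - s))) has_real_derivative D * exp (- c * (u - s))) (at u)"
        if "c \<noteq> 0" for c D u :: real
        using that by (auto intro!: derivative_eq_intros)
      from this [of "rate l" "C * (w + 2)"]
      show "((\<lambda>u. - (C * (w + 2) / rate l) * exp (- rate l * (u - s))) has_real_derivative ?e u) (at u)" for u
        using rate_pos by (simp add: mult_ac)
    qed (use C_nonneg w in auto)
    finally show ?thesis by simp
  qed
  ultimately show "\<bar>\<integral>\<omega>. (LINT u:{s..t}|lborel. h (Z u \<omega>) - cost_C h \<gamma> (r \<omega>)) \<partial>M\<bar> \<le> C * (w + 2) / rate l"
    using C_nonneg w rate_pos by (simp add: ennreal_le_iff)
qed

section \<open>The state at the start of a phase\<close>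

text \<open>All barriers are at most 0, so raising them to 0 only raises the path. The bound by free
  paths survives a change of phase because their increments add up.\<close>

lemma phase_scheme_below_reflection_at_0:
  assumes PS: "phase_scheme M F B \<theta> \<sigma> h x g r X Z Y W" and \<omega>: "\<omega> \<in> space M"
    and r: "\<And>k. r k \<omega> \<le> 0"
  shows "X k \<omega> \<le> x + incr 0 (\<tau> k) \<omega> \<or> (\<exists>u\<in>{0..\<tau> k}. X k \<omega> \<le> incr u (\<tau> k) \<omega>)"
proof (induction k)
  case 0
  then show ?case
    using PS \<omega> by (simp add: phase_scheme_def \<tau>_def)
next
  case (Suc k)
  have Z: "reflected_BM F B \<theta> \<sigma> (\<tau> k) (r k) (X k) (Z k) (Y k)"
    using PS by (simp add: phase_scheme_def)
  have W: "\<And>t. t \<in> {\<tau> k..<\<tau> (Suc k)} \<Longrightarrow> W t \<omega> = Z k t \<omega>"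
    and X: "X (Suc k) \<omega> = max (Lim (at_left (\<tau> (Suc k))) (\<lambda>t. W t \<omega>)) (r (Suc k) \<omega>)"
    using PS \<omega> by (auto simp: phase_scheme_def)
  have \<tau>: "0 \<le> \<tau> k" "\<tau> k < \<tau> (Suc k)"
    by (simp_all add: \<tau>_def)
  \<comment> \<open>\<open>W\<close> agrees with \<open>Z k\<close> only before the end of the
    phase; continuity of \<open>Z k\<close>, which is defined beyond it, identifies the left
    limit.\<close>
  have "((\<lambda>t. Z k t \<omega>) \<longlongrightarrow> Z k (\<tau> (Suc k)) \<omega>) (at (\<tau> (Suc k)) within {\<tau> k..})"
    using reflected_BM_measurable(6) [OF Z \<omega>] \<tau> by (auto simp: continuous_on_def)
  moreover have ev: "\<forall>\<^sub>F t in at_left (\<tau> (Suc k)). t \<in> {\<tau> k..<\<tau> (Suc k)}"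
    using eventually_at_left_real [OF \<tau>(2)] by (rule eventually_mono) auto
  have "at_left (\<tau> (Suc k)) \<le> at (\<tau> (Suc k)) within {\<tau> k..}"
    unfolding at_within_def
    using ev by (auto simp: le_inf_iff at_within_def le_principal eventually_inf_principal elim: eventually_mono)
  ultimately have "((\<lambda>t. Z k t \<omega>) \<longlongrightarrow> Z k (\<tau> (Suc k)) \<omega>) (at_left (\<tau> (Suc k)))"
    by (metis tendsto_mono)
  moreover have "\<forall>\<^sub>F t in at_left (\<tau> (Suc k)). W t \<omega> = Z k t \<omega>"
    using ev by (rule eventually_mono) (rule W)
  ultimately have "((\<lambda>t. W t \<omega>) \<longlongrightarrow> Z k (\<tau> (Suc k)) \<omega>) (at_left (\<tau> (Suc k)))"
    by (subst tendsto_cong)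
  then have "Lim (at_left (\<tau> (Suc k))) (\<lambda>t. W t \<omega>) = Z k (\<tau> (Suc k)) \<omega>"
    by (intro tendsto_Lim) simp_all
  then have X: "X (Suc k) \<omega> = max (Z k (\<tau> (Suc k)) \<omega>) (r (Suc k) \<omega>)"
    using X by simp
  show ?case
  proof (cases "Z k (\<tau> (Suc k)) \<omega> \<le> r (Suc k) \<omega>")
    case True
    \<comment> \<open>The state is the new barrier, at most \<open>0 = incr u u \<omega>\<close> for
      \<open>u\<close> the end of the phase.\<close>
    then show ?thesis
      using X r [of "Suc k"] \<tau> by (intro disjI2 bexI [of _ "\<tau> (Suc k)"]) auto
  next
    case False
    then have X: "X (Suc k) \<omega> = Z k (\<tau> (Suc k)) \<omega>"
      using X by simp
    \<comment> \<open>Without a push in this phase the earlier bound is extended by the increment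
      over the phase; otherwise the path restarts at \<open>u\<close> from
      \<open>r k \<omega> \<le> 0\<close>.\<close>
    from reflected_BM_attained [OF Z \<omega>, of "\<tau> (Suc k)"] \<tau>
    consider "Z k (\<tau> (Suc k)) \<omega> = X k \<omega> + incr (\<tau> k) (\<tau> (Suc k)) \<omega>"
      | u where "u \<in> {\<tau> k..\<tau> (Suc k)}" "Z k (\<tau> (Suc k)) \<omega> = r k \<omega> + incr u (\<tau> (Suc k)) \<omega>"
      by auto
    then show ?thesis
    proof cases
      case 1
      from Suc.IH show ?thesis
      proof
        assume "X k \<omega> \<le> x + incr 0 (\<tau> k) \<omega>"
        then show ?thesis
          using 1 X incr_add [of 0 "\<tau> k" \<omega> "\<tau> (Suc k)"] by simp
      next
        assume "\<exists>u\<in>{0..\<tau> k}. X k \<omega> \<le> incr u (\<tau> k) \<omega>"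
        then obtain u where "u \<in> {0..\<tau> k}" "X k \<omega> \<le> incr u (\<tau> k) \<omega>" by blast
        then show ?thesis
          using 1 X \<tau> incr_add [of u "\<tau> k" \<omega> "\<tau> (Suc k)"] by (intro disjI2 bexI [of _ u]) auto
      qed
    next
      case 2
      then show ?thesis
        using X \<tau> r [of k] by (intro disjI2 bexI [of _ u]) auto
    qed
  qed
qed

text \<open>The bound \<open>- r k \<omega> \<le> K\<close> costs the factor
  \<open>exp (l * K)\<close>; the rest is the moment of the path from \<open>x\<close> reflected at
  0.\<close>

lemma phase_scheme_exp_moment:
  assumes PS: "phase_scheme M F B \<theta> \<sigma> h x g r X Z Y W" and x: "0 \<le> x"
    and r: "\<And>k \<omega>. \<omega> \<in> space M \<Longrightarrow> r k \<omega> \<in> {- K..0}"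
  shows "(\<integral>\<^sup>+\<omega>. ennreal (exp (l * (X k \<omega> - r k \<omega>))) \<partial>M) \<le> ennreal (exp (l * K) * (4 + exp (l * x)))"
proof -
  interpret prob_space M by (rule prob_space_M)
  have "reflected_BM F B \<theta> \<sigma> (\<tau> k) (r k) (X k) (Z k) (Y k)"
    using PS by (simp add: phase_scheme_def)
  then have [measurable]: "X k \<in> borel_measurable M"
    by (intro measurable_F_M reflected_BM_measurable(3)) (simp_all add: \<tau>_def)
  have "(\<integral>\<^sup>+\<omega>. ennreal (exp (l * X k \<omega>)) \<partial>M) \<le> ennreal (exp (l * x)) + 4"
  proof (cases k)
    \<comment> \<open>As \<open>\<tau> 0 = 0\<close>, there is no time interval to compare on; the
      initial state is the constant \<open>x\<close>.\<close>
    case 0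
    then have "(\<integral>\<^sup>+\<omega>. ennreal (exp (l * X k \<omega>)) \<partial>M) = (\<integral>\<^sup>+\<omega>. ennreal (exp (l * x)) \<partial>M)"
      using PS by (intro nn_integral_cong) (simp add: phase_scheme_def)
    then show ?thesis
      using emeasure_space_1 by simp
  next
    case (Suc j)
    have "(1 :: real) < 2 ^ Suc j"
      by (rule one_less_power) auto
    then have "0 < \<tau> k"
      by (simp add: Suc \<tau>_def)
    then have "(\<integral>\<^sup>+\<omega>. ennreal (exp (l * X k \<omega>)) \<partial>M) \<le> (\<integral>\<^sup>+\<omega>. ennreal (exp (l * x)) \<partial>M) + 4"
      using r x by (intro nn_integral_exp_reflected_le [where s = 0 and t = "\<tau> k"] l_pos l_le
          phase_scheme_below_reflection_at_0 [OF PS]) auto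
    then show ?thesis
      using emeasure_space_1 by simp
  qed
  note X_le = this
  have "(\<integral>\<^sup>+\<omega>. ennreal (exp (l * (X k \<omega> - r k \<omega>))) \<partial>M) \<le> (\<integral>\<^sup>+\<omega>. ennreal (exp (l * K)) * ennreal (exp (l * X k \<omega>)) \<partial>M)"
  proof (intro nn_integral_mono)
    fix \<omega> assume "\<omega> \<in> space M"
    then have "l * (X k \<omega> - r k \<omega>) \<le> l * (K + X k \<omega>)"
      using r [of \<omega> k] l_pos by (intro mult_left_mono) auto
    then show "ennreal (exp (l * (X k \<omega> - r k \<omega>))) \<le> ennreal (exp (l * K)) * ennreal (exp (l * X k \<omega>))"
      by (subst ennreal_mult' [symmetric]) (auto simp: exp_add [symmetric] distrib_left intro!: ennreal_leI)
  qed
  also have "\<dots> \<le> ennreal (exp (l * K)) * (ennreal (exp (l * x)) + 4)"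
    by (subst nn_integral_cmult) (auto intro!: mult_left_mono X_le)
  also have "ennreal (exp (l * x)) + 4 = ennreal (4 + exp (l * x))"
    by (simp add: add.commute)
  also have "ennreal (exp (l * K)) * ennreal (4 + exp (l * x)) = ennreal (exp (l * K) * (4 + exp (l * x)))"
    by (rule ennreal_mult' [symmetric]) simp
  finally show ?thesis .
qed

section \<open>Summation over the phases\<close>

text \<open>Each of the \<open>phase_count T + 1\<close> phases, the incomplete last one included,
  contributes at most \<open>?D\<close>.\<close>

lemma regret_R1_le:
  assumes PS: "phase_scheme M F B \<theta> \<sigma> h x g r X Z Y W" and x: "0 \<le> x" and T: "1 \<le> T"
    and r: "\<And>k \<omega>. \<omega> \<in> space M \<Longrightarrow> r k \<omega> \<in> {- K..0}"
  shows "regret_R1 M h \<gamma> T r Z \<le> C * (exp (l * K) * (4 + exp (l * x)) + 2) / rate l * (log 2 T + 2)"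
proof -
  let ?w = "exp (l * K) * (4 + exp (l * x))"
  let ?D = "C * (?w + 2) / rate l"
  let ?I = "\<lambda>k t \<omega>. LINT u:{\<tau> k..t}|lborel. h (Z k u \<omega>) - cost_C h \<gamma> (r k \<omega>)"
  have Z: "reflected_BM F B \<theta> \<sigma> (\<tau> k) (r k) (X k) (Z k) (Y k)" for k
    using PS by (simp add: phase_scheme_def)
  have int: "integrable M (?I k t)" and le: "(\<integral>\<omega>. ?I k t \<omega> \<partial>M) \<le> ?D" for k t
    using integrated_cost_bound [where t = t, OF Z [of k] r _ phase_scheme_exp_moment [OF PS x r]] by simp_all
  let ?N = "phase_count T"
  have sum_D: "(\<Sum>k<?N. D) + D = D * (real ?N + 1)" for D :: real
    by (simp add: algebra_simps)
  have "regret_R1 M h \<gamma> T r Z = (\<Sum>k<?N. \<integral>\<omega>. ?I k (\<tau> (Suc k)) \<omega> \<partial>M) + (\<integral>\<omega>. ?I ?N T \<omega> \<partial>M)"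
    unfolding regret_R1_def Let_def by (subst Bochner_Integration.integral_sum) (rule int, rule refl)
  also have "\<dots> \<le> (\<Sum>k<?N. ?D) + ?D"
    by (intro add_mono sum_mono le)
  also have "\<dots> = ?D * (real ?N + 1)"
    by (rule sum_D)
  also have "\<dots> \<le> ?D * (log 2 T + 2)"
  proof (intro mult_left_mono)
    have "0 \<le> log 2 (T + 1)"
      using T by simp
    then have "real ?N \<le> log 2 (T + 1)"
      by (simp add: phase_count_def)
    \<comment> \<open>By \<open>1 \<le> T\<close> the shift to \<open>T + 1\<close> costs at most 1;
      the incomplete phase accounts for the other 1 in \<open>log 2 T + 2\<close>.\<close>
    also have "\<dots> \<le> log 2 (2 * T)"
      using T by simp
    also have "\<dots> = log 2 T + 1"
      using T by (simp add: log_mult)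
    finally show "real ?N + 1 \<le> log 2 T + 2" by simp
    show "0 \<le> ?D"
      using C_nonneg rate_pos by simp
  qed
  finally show ?thesis .
qed

text \<open>A single phase with constant barrier; the sign is reversed, so the other side of the
  absolute bound is used.\<close>

lemma regret_R4_le:
  assumes Z: "reflected_BM F B \<theta> \<sigma> 0 (\<lambda>_. r_opt h \<gamma>) (\<lambda>_. x) Z Y" and r: "r_opt h \<gamma> \<in> {- K..0}"
  shows "regret_R4 M h \<gamma> T Z \<le> C * (exp (l * (x + K)) + 2) / rate l"
proof -
  interpret prob_space M by (rule prob_space_M)
  let ?I = "\<lambda>\<omega>. LINT u:{0..T}|lborel. h (Z u \<omega>) - cost_C h \<gamma> (r_opt h \<gamma>)"
  have "(\<integral>\<^sup>+\<omega>. ennreal (exp (l * (x - r_opt h \<gamma>))) \<partial>M) \<le> ennreal (exp (l * (x + K)))"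
    using r l_pos emeasure_space_1 by (auto intro!: ennreal_leI)
  from integrated_cost_bound(2) [OF Z _ _ this] r
  have "- (\<integral>\<omega>. ?I \<omega> \<partial>M) \<le> C * (exp (l * (x + K)) + 2) / rate l"
    by (simp add: abs_le_iff)
  moreover have "(LINT u:{0..T}|lborel. cost_C h \<gamma> (r_opt h \<gamma>) - h (Z u \<omega>)) = - ?I \<omega>" for \<omega>
  proof -
    have "indicator {0..T} u *\<^sub>R (cost_C h \<gamma> (r_opt h \<gamma>) - h (Z u \<omega>))
        = - (indicator {0..T} u *\<^sub>R (h (Z u \<omega>) - cost_C h \<gamma> (r_opt h \<gamma>)))" for u
      by (simp add: algebra_simps)
    then show ?thesis
      by (simp only: set_lebesgue_integral_def Bochner_Integration.integral_minus)
  qed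
  ultimately show ?thesis
    by (simp only: regret_R4_def Bochner_Integration.integral_minus)
qed

end

section \<open>Specialisation to the two algorithms\<close>

theorem proposition3:
  fixes M :: "'a measure" and F :: "real \<Rightarrow> 'a measure" and B :: "real \<Rightarrow> 'a \<Rightarrow> real"
    and h :: "real \<Rightarrow> real"
    and \<theta> \<sigma> \<gamma> \<gamma>min b Kh a HK Ch x T :: real
    and g r X :: "nat \<Rightarrow> 'a \<Rightarrow> real" and Z Y :: "nat \<Rightarrow> real \<Rightarrow> 'a \<Rightarrow> real"
    and W :: "real \<Rightarrow> 'a \<Rightarrow> real"
    and g' r' X' :: "nat \<Rightarrow> 'a \<Rightarrow> real" and Z' Y' :: "nat \<Rightarrow> real \<Rightarrow> 'a \<Rightarrow> real"
    and W' :: "real \<Rightarrow> 'a \<Rightarrow> real"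
    and Zs Ys :: "real \<Rightarrow> 'a \<Rightarrow> real"
  assumes BM: "standard_BM M F B"
    and params: "\<theta> < 0" "\<sigma> > 0" "\<gamma> = - 2 * \<theta> / \<sigma>\<^sup>2" "0 < \<gamma>min" "\<gamma>min \<le> \<gamma>"
    and h: "cost_assumption h \<gamma>min b"
    and Kh: "Kh > 0" "\<forall>u\<ge>\<gamma>min. - Kh < r_opt h u \<and> r_opt h u < 0"
    and a: "a > 0" "\<forall>y\<ge>0. h y \<le> a * exp (b * y)"
    and HK: "HK > 0" "\<forall>y\<in>{- Kh..0}. h y \<le> HK"
    and Ch: "Ch = max a HK"
    and x: "x \<ge> 0" and T: "T \<ge> 1"
    and AU: "AU_algorithm M F B \<theta> \<sigma> h \<gamma>min x g r X Z Y W"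
    and AU_FH: "AU_FH_algorithm M F B \<theta> \<sigma> h \<gamma>min x g' r' X' Z' Y' W'"
    and Zs: "reflected_BM F B \<theta> \<sigma> 0 (\<lambda>_. r_opt h \<gamma>) (\<lambda>_. x) Zs Ys"
  shows "max (regret_R1 M h \<gamma> T r Z) (regret_R1 M h \<gamma> T r' Z')
           \<le> 8 * Ch * (2 + exp (\<gamma>min * Kh / 2) * (4 + exp (\<gamma>min * x / 2)))
               / (\<sigma>\<^sup>2 * \<gamma>min * (2 * \<gamma> - \<gamma>min)) * (log 2 T + 2) \<and>
         max (regret_R4 M h \<gamma> T Zs) (regret_R4 M h \<gamma> T Zs)
           \<le> 8 * Ch * (2 + exp (\<gamma>min * (x + Kh) / 2))
               / (\<sigma>\<^sup>2 * \<gamma>min * (2 * \<gamma> - \<gamma>min))"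
proof -
  have h': "\<And>z. 0 \<le> h z" "continuous_on UNIV h" "0 < b" "b < \<gamma>min / 2"
    using h by (auto simp: cost_assumption_def)
  interpret cost_BM \<theta> \<sigma> \<gamma> M F B h "\<gamma>min / 2" b Ch Kh
  proof
    fix r v :: real assume r: "r \<in> {- Kh..0}" and v: "0 \<le> v"
    show "h (r + v) \<le> Ch * exp (b * v)"
    \<comment> \<open>At or above 0 the constant \<open>a\<close> applies and
      \<open>r \<le> 0\<close> permits dropping \<open>r\<close> in the exponent; below 0 the
      argument lies in \<open>{- Kh..0}\<close> and \<open>exp (b * v) \<ge> 1\<close>.\<close>
    proof (cases "0 \<le> r + v")
      case True
      then have "h (r + v) \<le> a * exp (b * (r + v))"
        using a by blast
      also have "\<dots> \<le> Ch * exp (b * v)"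
        using r h'(3) a Ch by (intro mult_mono) auto
      finally show ?thesis .
    next
      case False
      then have "h (r + v) \<le> HK * 1"
        using HK r v by auto
      also have "\<dots> \<le> Ch * exp (b * v)"
        using v h'(3) HK Ch by (intro mult_mono) auto
      finally show ?thesis .
    qed
  qed (use BM params h' a Ch in auto)
  have opt: "r_opt h u \<in> {- Kh..0}" if "\<gamma>min \<le> u" for u
    using Kh that by (auto intro: less_imp_le)
  \<comment> \<open>The first barrier is 0; truncating the estimates at \<open>\<gamma>min\<close>
    puts all later ones in the range given by \<open>Kh\<close>, for both algorithms alike.\<close>
  have range: "q k \<omega> \<in> {- Kh..0}"
    if "phase_scheme M F B \<theta> \<sigma> h x e q X Z Y W" "\<And>k \<omega>. \<omega> \<in> space M \<Longrightarrow> \<gamma>min \<le> e (Suc k) \<omega>" "\<omega> \<in> space M"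
    for e q X Z Y W and k \<omega>
    using that Kh opt by (cases k) (auto simp: phase_scheme_def)
  have PS: "phase_scheme M F B \<theta> \<sigma> h x g r X Z Y W" "phase_scheme M F B \<theta> \<sigma> h x g' r' X' Z' Y' W'"
    and g: "\<And>k \<omega>. \<omega> \<in> space M \<Longrightarrow> \<gamma>min \<le> g (Suc k) \<omega>" "\<And>k \<omega>. \<omega> \<in> space M \<Longrightarrow> \<gamma>min \<le> g' (Suc k) \<omega>"
    using AU AU_FH by (simp_all add: AU_algorithm_def AU_FH_algorithm_def)
  have "rate (\<gamma>min / 2) = \<sigma>\<^sup>2 * \<gamma>min * (2 * \<gamma> - \<gamma>min) / 8"
    \<comment> \<open>Source of the factor 8: halving \<open>\<gamma>min\<close> contributes 2 in
      each of the two factors, and \<open>rate\<close> itself has a denominator 2.\<close>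
    by (simp add: rate_def field_simps)
  note rate_eq = this
  have D: "Ch * (w + 2) / rate (\<gamma>min / 2) = 8 * Ch * (2 + w) / (\<sigma>\<^sup>2 * \<gamma>min * (2 * \<gamma> - \<gamma>min))" for w
    unfolding rate_eq by (simp add: add.commute mult.commute [of 8])
  note R1 = regret_R1_le [OF PS(1) x T range [OF PS(1) g(1)]] regret_R1_le [OF PS(2) x T range [OF PS(2) g(2)]]
  note R4 = regret_R4_le [OF Zs opt [OF params(5)], of T]
  show ?thesis
    using R1 R4 unfolding D by simp
qed

end
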